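(* Let $\Gamma$ be the infinite dihedral group. The cyclic cohomology of the group ring $\mathbf{C}\Gamma$ is given by $$HC^n(\mathbf{C}\Gamma)\cong\begin{cases}\mathbf{C}^3\times\prod_{p\ge 1}\mathbf{C} & n=0,\\ 0 & n=1,3,5,\dots,\\ \mathbf{C}^3 & n=2,4,6,\dots\end{cases}$$
   Context: The infinite dihedral group is $\Gamma=\mathbf{Z}\times_\sigma\mathbf{Z}_2$, the semidirect product with $\mathbf{Z}_2$ acting on $\mathbf{Z}$ by inversion; it has generators $S,e$ with relations $e^2=1$, $eSe=S^{-1}$. $HC^n$ denotes (Connes) cyclic cohomology of a complex algebra: the cohomology of the complex of $(n+1)$-linear functionals $\varphi$ with $\varphi(a_1,\dots,a_n,a_0)=(-1)^n\varphi(a_0,\dots,a_n)$, with the Hochschild coboundary $b$. Here $\prod_{p\ge1}\mathbf{C}$ is the full direct product of countably many copies of $\mathbf{C}$. *)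

theory Defs
  imports Complex_Main "HOL-Library.Poly_Mapping" "HOL-Library.Z2"
    "HOL-Algebra.AbelCoset" "HOL-Algebra.Module"
begin

section \<open>The infinite dihedral group and its group ring\<close>

text \<open>
  \<open>Dih m s\<close> is the element \<open>S\<^sup>m e\<^sup>s\<close> of the semidirect product of the integers by the
  two-element group \<^typ>\<open>bit\<close>. The (non-commutative) group law is written additively,
  because \<^typ>\<open>'g \<Rightarrow>\<^sub>0 'r\<close> carries the convolution product with respect to the
  class \<^class>\<open>monoid_add\<close>.
\<close>

datatype dihedral = Dih int bit

instantiation dihedral :: group_add
begin

definition zero_dihedral :: dihedral
  where "0 = Dih 0 0"

fun plus_dihedral :: "dihedral \<Rightarrow> dihedral \<Rightarrow> dihedral"
  where "Dih m s + Dih n t = Dih (m + (if s = 0 then n else - n)) (s + t)"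

fun uminus_dihedral :: "dihedral \<Rightarrow> dihedral"
  where "- Dih m s = Dih (if s = 0 then - m else m) s"

definition minus_dihedral :: "dihedral \<Rightarrow> dihedral \<Rightarrow> dihedral"
  where "x - y = x + - (y :: dihedral)"

instance
proof
  fix a b c :: dihedral
  show "a + b + c = a + (b + c)"
    by (cases a; cases b; cases c) auto
  show "0 + a = a" "a + 0 = a" "- a + a = 0"
    by (cases a; auto simp: zero_dihedral_def)+
  show "a + - b = a - b"
    by (simp add: minus_dihedral_def)
qed

end

lemma dihedral_relations:
  defines "S \<equiv> Dih 1 0" and "e \<equiv> Dih 0 1"
  shows "e + e = 0" and "e + S + e = - S"
  by (simp_all add: S_def e_def zero_dihedral_def)

type_synonym dihedral_group_ring = "dihedral \<Rightarrow>\<^sub>0 complex"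

definition group_ring_scale :: "complex \<Rightarrow> ('g \<Rightarrow>\<^sub>0 complex) \<Rightarrow> ('g \<Rightarrow>\<^sub>0 complex)"
  where "group_ring_scale c = Poly_Mapping.map ((*) c)"

lemma lookup_group_ring_scale:
  "Poly_Mapping.lookup (group_ring_scale c x) g = c * Poly_Mapping.lookup x g"
  by (simp add: group_ring_scale_def Poly_Mapping.map.rep_eq when_def)

lemma vector_space_group_ring: "vector_space group_ring_scale"
  by unfold_locales
    (auto intro!: poly_mapping_eqI
      simp: lookup_group_ring_scale Poly_Mapping.lookup_add algebra_simps)

lemma single_zero_commute:
  fixes x :: "'g::monoid_add \<Rightarrow>\<^sub>0 complex"
  shows "Poly_Mapping.single 0 c * x = x * Poly_Mapping.single 0 c"
proof (induction x rule: Poly_Mapping.update_induct)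
  case const
  show ?case by simp
next
  case (update f k v)
  have "Poly_Mapping.update k v f = f + Poly_Mapping.single k v"
    using update.hyps(1)
    by (auto intro!: poly_mapping_eqI
        simp: Poly_Mapping.lookup_update Poly_Mapping.lookup_add Poly_Mapping.lookup_single
          Poly_Mapping.in_keys_iff when_def)
  with update.IH show ?case
    by (simp add: distrib_left distrib_right Poly_Mapping.mult_single mult.commute)
qed

lemma group_ring_scale_mult:
  fixes x y :: "'g::monoid_add \<Rightarrow>\<^sub>0 complex"
  shows "group_ring_scale c (x * y) = group_ring_scale c x * y"
    and "group_ring_scale c (x * y) = x * group_ring_scale c y"
  unfolding group_ring_scale_def Poly_Mapping.mult_map_scale_conv_mult
  by (simp_all only: mult.assoc flip: single_zero_commute)
    (simp_all only: single_zero_commute mult.assoc)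


section \<open>Complex vector spaces as modules\<close>

abbreviation complex_ring :: "complex ring"
  where "complex_ring \<equiv> \<lparr>carrier = UNIV, mult = (*), one = 1, zero = 0, add = (+)\<rparr>"

text \<open>
  The fields \<open>mult\<close> and \<open>one\<close>, which the record of modules inherits from the record of rings,
  play no role for modules and are left unspecified throughout.
\<close>

definition functional_module :: "('x \<Rightarrow> complex) set \<Rightarrow> (complex, 'x \<Rightarrow> complex) module"
  where "functional_module V =
    \<lparr>carrier = V, mult = undefined, one = undefined,
     zero = (\<lambda>_. 0), add = (\<lambda>f g x. f x + g x), smult = (\<lambda>c f x. c * f x)\<rparr>"

text \<open>
  The direct product of copies of the complex numbers indexed by the set \<open>I\<close>;
  families on \<open>I\<close> are normalised to vanish outside \<open>I\<close>.
\<close>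

definition complex_power :: "'i set \<Rightarrow> (complex, 'i \<Rightarrow> complex) module"
  where "complex_power I = functional_module {f. \<forall>i. i \<notin> I \<longrightarrow> f i = 0}"

definition module_prod :: "('r, 'a) module \<Rightarrow> ('r, 'b) module \<Rightarrow> ('r, 'a \<times> 'b) module"
  where "module_prod M N =
    \<lparr>carrier = carrier M \<times> carrier N, mult = undefined, one = undefined,
     zero = (\<zero>\<^bsub>M\<^esub>, \<zero>\<^bsub>N\<^esub>),
     add = (\<lambda>(x, y) (x', y'). (x \<oplus>\<^bsub>M\<^esub> x', y \<oplus>\<^bsub>N\<^esub> y')),
     smult = (\<lambda>c (x, y). (c \<odot>\<^bsub>M\<^esub> x, c \<odot>\<^bsub>N\<^esub> y))\<rparr>"

definition quotient_module :: "('r, 'a) module \<Rightarrow> 'a set \<Rightarrow> ('r, 'a set) module"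
  where "quotient_module M N =
    \<lparr>carrier = a_rcosets\<^bsub>M\<^esub> N, mult = undefined, one = undefined,
     zero = N, add = set_add M,
     smult = (\<lambda>c X. \<Union>x\<in>X. N +>\<^bsub>M\<^esub> (c \<odot>\<^bsub>M\<^esub> x))\<rparr>"

definition module_isomorphic :: "'r ring \<Rightarrow> ('r, 'a) module \<Rightarrow> ('r, 'b) module \<Rightarrow> bool"
  where "module_isomorphic R M N \<longleftrightarrow>
    (\<exists>f. bij_betw f (carrier M) (carrier N) \<and>
      (\<forall>x\<in>carrier M. \<forall>y\<in>carrier M. f (x \<oplus>\<^bsub>M\<^esub> y) = f x \<oplus>\<^bsub>N\<^esub> f y) \<and>
      (\<forall>c\<in>carrier R. \<forall>x\<in>carrier M. f (c \<odot>\<^bsub>M\<^esub> x) = c \<odot>\<^bsub>N\<^esub> f x))"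


section \<open>Cyclic cohomology of a complex algebra\<close>

text \<open>
  The algebra is the ring \<^typ>\<open>'a\<close> with scalar multiplication \<open>scale\<close>. A functional of \<open>k\<close>
  arguments is a function on lists, normalised to vanish on lists of length other than \<open>k\<close>.
\<close>

definition multilinear_functionals ::
    "(complex \<Rightarrow> 'a \<Rightarrow> 'a::ring_1) \<Rightarrow> nat \<Rightarrow> ('a list \<Rightarrow> complex) set"
  where "multilinear_functionals scale k =
    {\<phi>. (\<forall>xs. length xs \<noteq> k \<longrightarrow> \<phi> xs = 0) \<and>
        (\<forall>xs i. length xs = k \<longrightarrow> i < k \<longrightarrow>
          Vector_Spaces.linear scale (*) (\<lambda>a. \<phi> (xs[i := a])))}"

definition cyclic_cochains ::
    "(complex \<Rightarrow> 'a \<Rightarrow> 'a::ring_1) \<Rightarrow> nat \<Rightarrow> ('a list \<Rightarrow> complex) set"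
  where "cyclic_cochains scale n =
    {\<phi> \<in> multilinear_functionals scale (n + 1).
      \<forall>xs. length xs = n + 1 \<longrightarrow> \<phi> (rotate1 xs) = (- 1) ^ n * \<phi> xs}"

definition hochschild_coboundary ::
    "nat \<Rightarrow> ('a::ring_1 list \<Rightarrow> complex) \<Rightarrow> 'a list \<Rightarrow> complex"
  where "hochschild_coboundary n \<phi> xs =
    (if length xs = n + 2
     then (\<Sum>i\<le>n. (- 1) ^ i * \<phi> (take i xs @ [xs ! i * xs ! (i + 1)] @ drop (i + 2) xs))
       + (- 1) ^ (n + 1) * \<phi> ((last xs * hd xs) # butlast (tl xs))
     else 0)"

definition cyclic_cocycles ::
    "(complex \<Rightarrow> 'a \<Rightarrow> 'a::ring_1) \<Rightarrow> nat \<Rightarrow> ('a list \<Rightarrow> complex) set"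
  where "cyclic_cocycles scale n =
    {\<phi> \<in> cyclic_cochains scale n. hochschild_coboundary n \<phi> = (\<lambda>_. 0)}"

definition cyclic_coboundaries ::
    "(complex \<Rightarrow> 'a \<Rightarrow> 'a::ring_1) \<Rightarrow> nat \<Rightarrow> ('a list \<Rightarrow> complex) set"
  where "cyclic_coboundaries scale n =
    (case n of 0 \<Rightarrow> {\<lambda>_. 0}
     | Suc m \<Rightarrow> hochschild_coboundary m ` cyclic_cochains scale m)"

definition cyclic_cohomology ::
    "(complex \<Rightarrow> 'a \<Rightarrow> 'a::ring_1) \<Rightarrow> nat \<Rightarrow> (complex, ('a list \<Rightarrow> complex) set) module"
  where "cyclic_cohomology scale n =
    quotient_module (functional_module (cyclic_cocycles scale n)) (cyclic_coboundaries scale n)"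

abbreviation cyclic_cohomology_dihedral ::
    "nat \<Rightarrow> (complex, (dihedral_group_ring list \<Rightarrow> complex) set) module"
  where "cyclic_cohomology_dihedral \<equiv> cyclic_cohomology group_ring_scale"

end

theory Submission
  imports Defs "HOL-Library.Function_Algebras"
begin

text \<open>
  Write \<open>b\<close> for the Hochschild coboundary, \<open>b'\<close> for the alternating sum of the faces that
  multiply two neighbouring entries, \<open>\<rho>\<close> for the signed cyclic shift and
  \<open>N = 1 + \<rho> + \<rho>\<^sup>2 + \<dots>\<close> for the norm. On the multilinear functionals of a unital complex
  algebra, \<open>b b = 0\<close>, \<open>b' b' = 0\<close>, \<open>N b' = b N\<close> and \<open>(\<rho> - 1) b \<rho> = \<rho> b' (\<rho> - 1)\<close>;
  moreover \<open>b'\<close> is exact, because of the unit, and the kernel of \<open>N\<close> is the image of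
  \<open>\<rho> - 1\<close>, because one can divide by the arity. Therefore \<open>\<alpha>\<close> and \<open>\<beta>\<close> with
  \<open>b' \<alpha> = (\<rho> - 1) \<beta>\<close> link a cyclic cocycle \<open>N \<alpha>\<close> of degree \<open>n\<close> with a cyclic
  cocycle \<open>b \<rho> \<beta>\<close> of degree \<open>n + 2\<close>; this is Connes' periodicity (\<open>zigzag_exists\<close>,
  \<open>zigzag_coboundary\<close>). Every cyclic cocycle of degree \<open>n + 2\<close> that is a Hochschild coboundary is
  reached in this way (\<open>zigzag_surjective\<close>).

  So if the Hochschild cohomology of an algebra vanishes in all degrees from two on, its cyclic
  cohomology is governed by degrees 0 and 1. If \<open>HC\<^sup>1\<close> vanishes, so does \<open>HC\<^sup>n\<close> for all odd \<open>n\<close>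
  (\<open>odd_cyclic_cocycles_exact\<close>). In even degrees classes are detected by their values at
  \<open>(p, \<dots>, p)\<close> for idempotents \<open>p\<close>: these values vanish on coboundaries, and along a zigzag they
  change only by a nonzero factor (\<open>coboundary_pairing\<close>, \<open>zigzag_pairing\<close>). A cocycle with zero
  values descends to a trace with zero values, and it remains to see that such a trace dies in degree 2
  (\<open>even_cyclic_cocycles_exact\<close>).

  The geometry of the infinite dihedral group supplies what this needs. It acts simply transitively on
  the vertices of a line, and integration along the paths of the line contracts the Hochschild complex
  from degree two on (\<open>hochschild_cocycle_exact\<close>). A cyclic 1-cocycle vanishes on commuting pairs and
  hence has a potential on each conjugacy class (\<open>cyclic_cocycle_1_exact\<close>). The traces are the class
  functions. There are three conjugacy classes of elements of finite order, those of \<open>1\<close>, \<open>e\<close> and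
  \<open>S e\<close>; they are seen by the idempotents \<open>1\<close>, \<open>(1 + e) / 2\<close> and \<open>(1 + S e) / 2\<close> and survive in
  all even degrees. The classes \<open>{S\<^sup>p, S\<^sup>-\<^sup>p}\<close> with \<open>p \<ge> 1\<close> contribute the infinite product in
  degree 0 and die in degree 2, because their centraliser \<open>\<int>\<close> has a nonzero class in degree 1
  (\<open>dihedral_trace_killed\<close>).
\<close>

section \<open>Shift, faces and norm\<close>

text \<open>
  The sign is that of a cycle of length \<open>length xs\<close>, so that cyclic cochains are
  exactly the multilinear functionals fixed by the shift. Functionals carry their arity only through
  the length of the list, hence one operator serves all degrees.
\<close>

definition cyclic_shift :: "('a list \<Rightarrow> complex) \<Rightarrow> 'a list \<Rightarrow> complex"
  where "cyclic_shift \<phi> xs = (- 1) ^ (length xs + 1) * \<phi> (rotate1 xs)"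

text \<open>
  All other faces are conjugates of this one under the cyclic shift. The value 0 on short lists keeps the face of a functional of positive arity multilinear.
\<close>

definition first_face :: "('a::times list \<Rightarrow> complex) \<Rightarrow> 'a list \<Rightarrow> complex"
  where "first_face \<phi> xs = (case xs of x # y # zs \<Rightarrow> \<phi> (x * y # zs) | _ \<Rightarrow> 0)"

text \<open>
  The operator usually written \<open>b'\<close>, the alternating sum of the faces that
  multiply two neighbouring entries. Peeling off the first entry makes
  \<open>b'b' = 0\<close> and the contraction by the unit short inductions on the list.
\<close>

fun bar_coboundary :: "('a::times list \<Rightarrow> complex) \<Rightarrow> 'a list \<Rightarrow> complex"
  where
    "bar_coboundary \<phi> (x # y # zs) = \<phi> (x * y # zs) - bar_coboundary (\<lambda>ws. \<phi> (x # ws)) (y # zs)"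
  | "bar_coboundary \<phi> _ = 0"

text \<open>
  The operator \<open>N\<close> of Connes' complex on functionals of arity \<open>k\<close>.
\<close>

definition cyclic_norm :: "nat \<Rightarrow> ('a list \<Rightarrow> complex) \<Rightarrow> 'a list \<Rightarrow> complex"
  where "cyclic_norm k \<phi> = (\<Sum>i<k. (cyclic_shift ^^ i) \<phi>)"

lemma sum_fun_apply: "(\<Sum>i\<in>A. f i) x = (\<Sum>i\<in>A. f i x :: complex)"
  by (induction A rule: infinite_finite_induct) auto

section \<open>The bar coboundary\<close>

lemma bar_coboundary_cong:
  assumes "\<And>ys. Suc (length ys) = length xs \<Longrightarrow> \<phi> ys = \<psi> ys"
  shows "bar_coboundary \<phi> xs = bar_coboundary \<psi> xs"
  using assms
proof (induction \<phi> xs arbitrary: \<psi> rule: bar_coboundary.induct)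
  case (1 \<phi> x y zs)
  have "bar_coboundary (\<lambda>ws. \<phi> (x # ws)) (y # zs) = bar_coboundary (\<lambda>ws. \<psi> (x # ws)) (y # zs)"
    by (rule "1.IH") (simp add: "1.prems")
  then show ?case by (simp add: "1.prems")
qed auto

lemma bar_coboundary_diff:
  "bar_coboundary (\<lambda>ws. \<phi> ws - \<psi> ws) xs = bar_coboundary \<phi> xs - bar_coboundary \<psi> xs"
  by (induction \<phi> xs arbitrary: \<psi> rule: bar_coboundary.induct) auto

lemma bar_coboundary_scale:
  "bar_coboundary (\<lambda>ws. c * \<phi> ws) xs = c * bar_coboundary \<phi> xs"
  by (induction \<phi> xs rule: bar_coboundary.induct) (auto simp: algebra_simps)

lemma bar_coboundary_zero: "bar_coboundary (\<lambda>ws. 0) xs = 0"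
  using bar_coboundary_scale[of 0 "\<lambda>_. 0"] by simp

text \<open>
  The mirror image of the defining recursion; it lets the last two entries be split off.
\<close>

lemma bar_coboundary_snoc:
  "bar_coboundary \<phi> (xs @ [y, z]) =
    bar_coboundary (\<lambda>ws. \<phi> (ws @ [z])) (xs @ [y]) + (- 1) ^ length xs * \<phi> (xs @ [y * z])"
proof (induction xs arbitrary: \<phi>)
  case (Cons x xs)
  then show ?case
    by (cases xs) (simp_all add: Cons[of "\<lambda>ws. \<phi> (x # ws)", simplified])
qed simp

lemma bar_coboundary_left_mult:
  fixes \<phi> :: "'a::semigroup_mult list \<Rightarrow> complex"
  shows "bar_coboundary (\<lambda>ws. \<phi> (a * hd ws # tl ws)) (x # xs) = bar_coboundary \<phi> (a * x # xs)"
  by (cases xs) (simp_all add: mult.assoc)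

text \<open>
  Unfolding the recursion twice, the terms in which \<open>x\<close> is multiplied cancel by
  associativity, and what remains is the claim for the functional with \<open>x\<close> inserted in
  front.
\<close>

lemma bar_coboundary_square:
  fixes \<phi> :: "'a::semigroup_mult list \<Rightarrow> complex"
  shows "bar_coboundary (bar_coboundary \<phi>) xs = 0"
proof (induction xs arbitrary: \<phi>)
  case (Cons x xs)
  show ?case
  proof (cases xs)
    case xs: (Cons y ys)
    have "bar_coboundary (\<lambda>ws. bar_coboundary \<phi> (x # ws)) (y # ys) =
        bar_coboundary (\<lambda>ws. \<phi> (x * hd ws # tl ws) - bar_coboundary (\<lambda>us. \<phi> (x # us)) ws) (y # ys)"
    proof (cases ys)
      case Nil then show ?thesis by simp
    next
      case (Cons z zs)
      show ?thesis
        by (rule bar_coboundary_cong) (use Cons in \<open>auto simp: length_Suc_conv\<close>)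
    qed
    also have "\<dots> = bar_coboundary \<phi> (x * y # ys)"
      using Cons[of "\<lambda>us. \<phi> (x # us)"] xs
      by (simp add: bar_coboundary_diff bar_coboundary_left_mult)
    finally show ?thesis using xs by simp
  qed simp
qed simp

text \<open>
  Inserting the unit in front is a contracting homotopy for the bar coboundary: the first face
  absorbs the unit.
\<close>

lemma bar_coboundary_unit:
  fixes \<phi> :: "'a::monoid_mult list \<Rightarrow> complex"
  assumes "xs \<noteq> []"
  shows "bar_coboundary \<phi> (1 # xs) = \<phi> xs - bar_coboundary (\<lambda>ws. \<phi> (1 # ws)) xs"
  using assms by (cases xs) simp_all

lemma bar_coboundary_sum_faces:
  "bar_coboundary \<phi> xs =
    (\<Sum>i<length xs - 1. (- 1) ^ i * \<phi> (take i xs @ [xs ! i * xs ! (i + 1)] @ drop (i + 2) xs))"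
proof (induction \<phi> xs rule: bar_coboundary.induct)
  case (1 \<phi> x y zs)
  then show ?case
    by (simp add: sum.lessThan_Suc_shift sum_negf del: sum.lessThan_Suc)
qed simp_all

section \<open>The Hochschild coboundary\<close>

lemma hochschild_coboundary_conv_bar:
  assumes "length xs = n"
  shows "hochschild_coboundary n \<phi> (x # xs @ [z]) =
    bar_coboundary \<phi> (x # xs @ [z]) + (- 1) ^ (n + 1) * \<phi> (z * x # xs)"
  using assms
  by (simp add: hochschild_coboundary_def bar_coboundary_sum_faces lessThan_Suc_atMost del: sum.lessThan_Suc)

lemma hochschild_coboundary_wrong_length:
  "length xs \<noteq> n + 2 \<Longrightarrow> hochschild_coboundary n \<phi> xs = 0"
  by (simp add: hochschild_coboundary_def)

lemma list_end_cases:
  assumes "length xs = n + 2"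
  obtains x ys z where "xs = x # ys @ [z]" "length ys = n"
proof -
  from assms obtain x ws where "xs = x # ws" "length ws = Suc n" by (cases xs) auto
  moreover from this obtain ys z where "ws = ys @ [z]" "length ys = n"
    by (cases ws rule: rev_cases) auto
  ultimately show ?thesis using that by blast
qed

text \<open>
  Write \<open>b = b' \<plusminus> t\<close>, where \<open>t\<close> multiplies the last entry into the first.
  The terms \<open>b't\<close> and \<open>tb'\<close> cancel up to the face in which the last two
  entries and the first are multiplied together, and that one cancels against \<open>tt\<close>.
\<close>

lemma hochschild_coboundary_square:
  fixes \<phi> :: "'a::ring_1 list \<Rightarrow> complex"
  shows "hochschild_coboundary (Suc n) (hochschild_coboundary n \<phi>) xs = 0"
proof (cases "length xs = Suc n + 2")
  case True
  then obtain x us z where xs: "xs = x # us @ [z]" "length us = Suc n" by (rule list_end_cases)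
  then obtain ys y where us: "us = ys @ [y]" "length ys = n"
    by (cases us rule: rev_cases) auto
  let ?t = "\<lambda>ws :: 'a list. \<phi> (last ws * hd ws # butlast (tl ws))"
  have 1: "bar_coboundary (hochschild_coboundary n \<phi>) xs =
      bar_coboundary (\<lambda>ws. bar_coboundary \<phi> ws - (- ((- 1) ^ (n + 1))) * ?t ws) xs"
  proof (rule bar_coboundary_cong)
    fix ws :: "'a list" assume "Suc (length ws) = length xs"
    with xs have "length ws = n + 2" by simp
    then obtain x us z where "ws = x # us @ [z]" "length us = n" by (rule list_end_cases)
    then show "hochschild_coboundary n \<phi> ws = bar_coboundary \<phi> ws - (- ((- 1) ^ (n + 1))) * ?t ws"
      by (simp add: hochschild_coboundary_conv_bar)
  qed
  have "bar_coboundary ?t xs = bar_coboundary (\<lambda>ws. ?t (ws @ [z])) (x # ys @ [y])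
      + (- 1) ^ (n + 1) * ?t (x # ys @ [y * z])"
    using bar_coboundary_snoc[of ?t "x # ys" y z] us xs by simp
  also have "bar_coboundary (\<lambda>ws. ?t (ws @ [z])) (x # ys @ [y]) =
      bar_coboundary (\<lambda>ws. \<phi> (z * hd ws # tl ws)) (x # ys @ [y])"
  proof (rule bar_coboundary_cong)
    fix ws :: "'a list" assume "Suc (length ws) = length (x # ys @ [y])"
    then show "?t (ws @ [z]) = \<phi> (z * hd ws # tl ws)" by (cases ws) auto
  qed
  also have "\<dots> = bar_coboundary \<phi> (z * x # ys @ [y])"
    by (rule bar_coboundary_left_mult)
  finally have 2: "bar_coboundary ?t xs = bar_coboundary \<phi> (z * x # ys @ [y])
      + (- 1) ^ (n + 1) * \<phi> (y * z * x # ys)" by simp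
  have 3: "bar_coboundary (hochschild_coboundary n \<phi>) xs = (- 1) ^ (n + 1) * bar_coboundary ?t xs"
    unfolding 1 bar_coboundary_diff bar_coboundary_square bar_coboundary_scale by simp
  have "hochschild_coboundary (Suc n) (hochschild_coboundary n \<phi>) xs =
      (- 1) ^ (n + 1) * bar_coboundary ?t xs + (- 1) ^ n * hochschild_coboundary n \<phi> (z * x # ys @ [y])"
    using xs us hochschild_coboundary_conv_bar[OF xs(2), of "hochschild_coboundary n \<phi>" x z] 3
    by simp
  then show ?thesis
    using us by (simp add: 2 hochschild_coboundary_conv_bar algebra_simps)
qed (simp add: hochschild_coboundary_wrong_length)

section \<open>Faces as conjugates under the cyclic shift\<close>

lemma cyclic_shift_power:
  "(cyclic_shift ^^ m) \<phi> xs = (- 1) ^ (m * (length xs + 1)) * \<phi> (rotate m xs)"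
proof (induction m arbitrary: xs)
  case (Suc m)
  have "rotate m (rotate1 xs) = rotate (Suc m) xs"
    by (metis rotate_Suc rotate1_rotate_swap)
  moreover have "(cyclic_shift ^^ Suc m) \<phi> xs = (- 1) ^ (length xs + 1) * (cyclic_shift ^^ m) \<phi> (rotate1 xs)"
    by (simp only: funpow.simps o_apply cyclic_shift_def)
  ultimately show ?case
    by (simp only: Suc) (simp add: power_add)
qed simp

text \<open>
  Rotating by \<open>i\<close> brings the entries \<open>i\<close> and \<open>i + 1\<close> to the front;
  after multiplying them, rotating back restores the order. The two shifts act on lists of different
  lengths, and the surplus sign is the one with which the face enters the coboundary.
\<close>

lemma cyclic_shift_conj_first_face:
  assumes "length xs = Suc k" "i < k"
  shows "(cyclic_shift ^^ i) (first_face ((cyclic_shift ^^ (k - i)) \<phi>)) xs =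
    (- 1) ^ i * \<phi> (take i xs @ [xs ! i * xs ! (i + 1)] @ drop (i + 2) xs)"
proof -
  let ?y = "xs ! i * xs ! Suc i # drop (i + 2) xs"
  obtain j where k: "k = i + j" using assms(2) less_imp_add_positive by blast
  have "rotate i xs = xs ! i # xs ! Suc i # drop (i + 2) xs @ take i xs"
    using assms by (simp add: rotate_drop_take Cons_nth_drop_Suc)
  then have "first_face \<psi> (rotate i xs) = \<psi> (?y @ take i xs)" for \<psi>
    by (simp add: first_face_def)
  moreover have "rotate j (?y @ take i xs) = take i xs @ ?y"
  proof -
    have "j = length ?y" using assms k by simp
    then show ?thesis by (simp only: rotate_append)
  qed
  moreover have "(- 1) ^ (i * (k + 2)) * (- 1) ^ (j * (k + 1)) = ((- 1) ^ i :: complex)"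
    unfolding power_add[symmetric] k by (simp add: minus_one_power_iff)
  moreover have "length (?y @ take i xs) = k" using assms k by simp
  ultimately show ?thesis
    using assms(1) k
    by (simp only: cyclic_shift_power) (simp add: mult.assoc[symmetric])
qed

lemma cyclic_shift_add: "cyclic_shift (\<phi> + \<psi>) = cyclic_shift \<phi> + cyclic_shift \<psi>"
  by (simp add: cyclic_shift_def fun_eq_iff algebra_simps)

lemma cyclic_shift_diff: "cyclic_shift (\<phi> - \<psi>) = cyclic_shift \<phi> - cyclic_shift \<psi>"
  by (simp add: cyclic_shift_def fun_eq_iff algebra_simps)

lemma cyclic_shift_scale: "cyclic_shift (\<lambda>xs. c * \<phi> xs) = (\<lambda>xs. c * cyclic_shift \<phi> xs)"
  by (simp add: cyclic_shift_def fun_eq_iff)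

lemma cyclic_shift_zero: "cyclic_shift 0 = 0"
  by (simp add: cyclic_shift_def fun_eq_iff)

lemma cyclic_shift_sum: "cyclic_shift (\<Sum>i\<in>A. \<phi> i) = (\<Sum>i\<in>A. cyclic_shift (\<phi> i))"
  by (induction A rule: infinite_finite_induct) (simp_all add: cyclic_shift_add cyclic_shift_zero del: plus_fun_apply zero_fun_apply)

lemma first_face_add: "first_face (\<phi> + \<psi>) = first_face \<phi> + first_face \<psi>"
  by (simp add: first_face_def fun_eq_iff split: list.split)

lemma first_face_zero: "first_face 0 = 0"
  by (simp add: first_face_def fun_eq_iff split: list.split)

lemma first_face_sum: "first_face (\<Sum>i\<in>A. \<phi> i) = (\<Sum>i\<in>A. first_face (\<phi> i))"
  by (induction A rule: infinite_finite_induct) (simp_all add: first_face_add first_face_zero del: plus_fun_apply zero_fun_apply)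

lemma cyclic_shift_funpow_add:
  "(cyclic_shift ^^ m) (\<phi> + \<psi>) = (cyclic_shift ^^ m) \<phi> + (cyclic_shift ^^ m) \<psi>"
  by (induction m) (simp_all add: cyclic_shift_add del: plus_fun_apply)

lemma cyclic_shift_funpow_diff:
  "(cyclic_shift ^^ m) (\<phi> - \<psi>) = (cyclic_shift ^^ m) \<phi> - (cyclic_shift ^^ m) \<psi>"
  by (induction m) (simp_all add: cyclic_shift_diff del: minus_apply)

lemma cyclic_shift_funpow_fixed: "cyclic_shift \<phi> = \<phi> \<Longrightarrow> (cyclic_shift ^^ m) \<phi> = \<phi>"
  by (induction m) simp_all

lemma bar_coboundary_diff_fun:
  "bar_coboundary (\<phi> - \<psi>) = bar_coboundary \<phi> - bar_coboundary \<psi>"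
  using bar_coboundary_diff[of \<phi> \<psi>] by (simp add: fun_eq_iff fun_diff_def)

lemma bar_coboundary_zero_fun: "bar_coboundary 0 = 0"
  by (rule ext) (simp add: zero_fun_def bar_coboundary_zero)

lemma hochschild_coboundary_diff:
  "hochschild_coboundary n (\<phi> - \<psi>) = hochschild_coboundary n \<phi> - hochschild_coboundary n \<psi>"
  by (simp add: hochschild_coboundary_def fun_eq_iff sum_subtractf algebra_simps)

lemma hochschild_coboundary_add:
  "hochschild_coboundary n (\<phi> + \<psi>) = hochschild_coboundary n \<phi> + hochschild_coboundary n \<psi>"
  by (simp add: hochschild_coboundary_def fun_eq_iff sum.distrib algebra_simps)

lemma hochschild_coboundary_scale:
  "hochschild_coboundary n (\<lambda>xs. c * \<phi> xs) = (\<lambda>xs. c * hochschild_coboundary n \<phi> xs)"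
  by (auto simp add: hochschild_coboundary_def fun_eq_iff sum_distrib_left algebra_simps)

lemma hochschild_coboundary_zero: "hochschild_coboundary n 0 = 0"
  using hochschild_coboundary_scale[of n 0 0] by (simp add: zero_fun_def)

lemma hochschild_coboundary_square_fun:
  "hochschild_coboundary (Suc n) (hochschild_coboundary n \<phi>) = 0"
  by (simp add: fun_eq_iff hochschild_coboundary_square)

lemma bar_coboundary_square_fun:
  "bar_coboundary (bar_coboundary (\<phi> :: 'a::semigroup_mult list \<Rightarrow> complex)) = 0"
  by (simp add: fun_eq_iff bar_coboundary_square)

lemma rotation_period:
  assumes "\<And>xs. length xs \<noteq> k \<Longrightarrow> \<phi> xs = 0"
  shows "(cyclic_shift ^^ k) \<phi> = \<phi>"
proof
  fix xs show "(cyclic_shift ^^ k) \<phi> xs = \<phi> xs"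
    using assms[of xs] assms[of "rotate k xs"]
    by (cases "length xs = k") (auto simp: cyclic_shift_power minus_one_power_iff)
qed

section \<open>Multilinear functionals on an algebra\<close>

locale complex_algebra = vector_space scale
  for scale :: "complex \<Rightarrow> 'a::ring_1 \<Rightarrow> 'a" +
  assumes scale_mult_left: "scale c (x * y) = scale c x * y"
    and scale_mult_right: "scale c (x * y) = x * scale c y"
begin

abbreviation Multi :: "nat \<Rightarrow> ('a list \<Rightarrow> complex) set"
  where "Multi \<equiv> multilinear_functionals scale"

abbreviation Cyc :: "nat \<Rightarrow> ('a list \<Rightarrow> complex) set"
  where "Cyc \<equiv> cyclic_cochains scale"

lemma linear_functional_iff:
  "Vector_Spaces.linear scale (*) f \<longleftrightarrow>
    (\<forall>x y. f (x + y) = f x + f y) \<and> (\<forall>c x. f (scale c x) = (c :: complex) * f x)"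
proof -
  have "vector_space ((*) :: complex \<Rightarrow> _)" by unfold_locales (simp_all add: algebra_simps)
  then show ?thesis
    using vector_space_axioms
    by (auto simp: Vector_Spaces.linear_iff_module_hom module_hom_iff
        module_iff_vector_space)
qed

lemma multilinear_iff:
  "\<phi> \<in> Multi k \<longleftrightarrow> (\<forall>xs. length xs \<noteq> k \<longrightarrow> \<phi> xs = 0) \<and>
    (\<forall>us vs. Suc (length us + length vs) = k \<longrightarrow>
      (\<forall>a b. \<phi> (us @ (a + b) # vs) = \<phi> (us @ a # vs) + \<phi> (us @ b # vs)) \<and>
      (\<forall>c a. \<phi> (us @ scale c a # vs) = c * \<phi> (us @ a # vs)))"
  (is "?L \<longleftrightarrow> ?R")
proof
  assume L: ?L
  have lin: "Vector_Spaces.linear scale (*) (\<lambda>a. \<phi> (us @ a # vs))"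
    if "Suc (length us + length vs) = k" for us vs
  proof -
    let ?xs = "us @ undefined # vs"
    have "length ?xs = k" "length us < k" using that by auto
    then have "Vector_Spaces.linear scale (*) (\<lambda>a. \<phi> (?xs[length us := a]))"
      using L unfolding multilinear_functionals_def by blast
    then show ?thesis by simp
  qed
  then show ?R
    using L by (simp add: linear_functional_iff) (simp add: multilinear_functionals_def)
next
  assume R: ?R
  have "Vector_Spaces.linear scale (*) (\<lambda>a. \<phi> (xs[i := a]))" if "length xs = k" "i < k" for xs i
  proof -
    have "\<phi> (xs[i := a]) = \<phi> (take i xs @ a # drop (Suc i) xs)" for a
      using that by (simp add: upd_conv_take_nth_drop)
    moreover have "Suc (length (take i xs) + length (drop (Suc i) xs)) = k" using that by simp
    ultimately show ?thesis using R by (simp only: linear_functional_iff) blast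
  qed
  with R show ?L by (auto simp: multilinear_functionals_def)
qed

lemma multi_support: "\<phi> \<in> Multi k \<Longrightarrow> length xs \<noteq> k \<Longrightarrow> \<phi> xs = 0"
  by (simp add: multilinear_iff)

lemma multi_slot_add:
  "\<phi> \<in> Multi k \<Longrightarrow> Suc (length us + length vs) = k \<Longrightarrow>
    \<phi> (us @ (a + b) # vs) = \<phi> (us @ a # vs) + \<phi> (us @ b # vs)"
  by (simp add: multilinear_iff)

lemma multi_slot_scale:
  "\<phi> \<in> Multi k \<Longrightarrow> Suc (length us + length vs) = k \<Longrightarrow>
    \<phi> (us @ scale c a # vs) = c * \<phi> (us @ a # vs)"
  by (simp add: multilinear_iff)

lemma multi_zero: "0 \<in> Multi k"
  by (simp add: multilinear_iff)

lemma multi_add: "\<phi> \<in> Multi k \<Longrightarrow> \<psi> \<in> Multi k \<Longrightarrow> \<phi> + \<psi> \<in> Multi k"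
  by (auto simp add: multilinear_iff algebra_simps)

lemma multi_diff: "\<phi> \<in> Multi k \<Longrightarrow> \<psi> \<in> Multi k \<Longrightarrow> \<phi> - \<psi> \<in> Multi k"
  by (auto simp add: multilinear_iff algebra_simps)

lemma multi_scale: "\<phi> \<in> Multi k \<Longrightarrow> (\<lambda>xs. c * \<phi> xs) \<in> Multi k"
  by (auto simp add: multilinear_iff algebra_simps)

lemma multi_sum: "(\<And>i. i \<in> A \<Longrightarrow> \<phi> i \<in> Multi k) \<Longrightarrow> (\<Sum>i\<in>A. \<phi> i) \<in> Multi k"
  by (induction A rule: infinite_finite_induct) (auto intro: multi_add multi_zero)

lemma multi_cyclic_shift:
  assumes "\<phi> \<in> Multi k"
  shows "cyclic_shift \<phi> \<in> Multi k"
  unfolding multilinear_iff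
proof (intro conjI allI impI)
  fix us vs :: "'a list" and a b c assume k: "Suc (length us + length vs) = k"
  show "cyclic_shift \<phi> (us @ (a + b) # vs) = cyclic_shift \<phi> (us @ a # vs) + cyclic_shift \<phi> (us @ b # vs)"
    using k multi_slot_add[OF assms, of vs "[]" a b] multi_slot_add[OF assms, of "tl us" "vs @ [hd us]" a b]
    by (cases us) (simp_all add: cyclic_shift_def algebra_simps)
  show "cyclic_shift \<phi> (us @ scale c a # vs) = c * cyclic_shift \<phi> (us @ a # vs)"
    using k multi_slot_scale[OF assms, of vs "[]" c a] multi_slot_scale[OF assms, of "tl us" "vs @ [hd us]" c a]
    by (cases us) (simp_all add: cyclic_shift_def algebra_simps)
qed (simp add: cyclic_shift_def multi_support[OF assms])

lemma multi_cyclic_shift_funpow: "\<phi> \<in> Multi k \<Longrightarrow> (cyclic_shift ^^ m) \<phi> \<in> Multi k"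
  by (induction m) (simp_all add: multi_cyclic_shift)

lemma multi_first_face:
  assumes "\<phi> \<in> Multi k" "k > 0"
  shows "first_face \<phi> \<in> Multi (Suc k)"
  unfolding multilinear_iff
proof (intro conjI allI impI)
  fix xs :: "'a list" assume "length xs \<noteq> Suc k"
  then show "first_face \<phi> xs = 0"
    using multi_support[OF assms(1)] by (auto simp: first_face_def split: list.split)
next
  fix us vs :: "'a list" and a b c assume k: "Suc (length us + length vs) = Suc k"
  have "us = [] \<and> (\<exists>v vs'. vs = v # vs') \<or> (\<exists>u. us = [u]) \<or> (\<exists>u w us'. us = u # w # us')"
    using k assms(2) by (cases us; cases vs; cases "tl us") auto
  then consider (a) v vs' where "us = []" "vs = v # vs'" | (b) u where "us = [u]"
    | (c) u w us' where "us = u # w # us'" by blast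
  then have "first_face \<phi> (us @ (a + b) # vs) = first_face \<phi> (us @ a # vs) + first_face \<phi> (us @ b # vs)
      \<and> first_face \<phi> (us @ scale c a # vs) = c * first_face \<phi> (us @ a # vs)"
  proof cases
    case a then show ?thesis
      using k multi_slot_add[OF assms(1), of "[]" vs' "a * v" "b * v"] multi_slot_scale[OF assms(1), of "[]" vs' c "a * v"]
      by (simp add: first_face_def distrib_right flip: scale_mult_left)
  next
    case b then show ?thesis
      using k multi_slot_add[OF assms(1), of "[]" vs "u * a" "u * b"] multi_slot_scale[OF assms(1), of "[]" vs c "u * a"]
      by (simp add: first_face_def distrib_left flip: scale_mult_right)
  next
    case c then show ?thesis
      using k multi_slot_add[OF assms(1), of "u * w # us'" vs a b] multi_slot_scale[OF assms(1), of "u * w # us'" vs c a]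
      by (simp add: first_face_def)
  qed
  then show "first_face \<phi> (us @ (a + b) # vs) = first_face \<phi> (us @ a # vs) + first_face \<phi> (us @ b # vs)"
    and "first_face \<phi> (us @ scale c a # vs) = c * first_face \<phi> (us @ a # vs)"
    by blast+
qed

lemma multi_insert_unit:
  assumes "\<phi> \<in> Multi (Suc k)"
  shows "(\<lambda>xs. \<phi> (1 # xs)) \<in> Multi k"
  unfolding multilinear_iff
proof (intro conjI allI impI)
  fix us vs :: "'a list" and a b c assume "Suc (length us + length vs) = k"
  then show "\<phi> (1 # us @ (a + b) # vs) = \<phi> (1 # us @ a # vs) + \<phi> (1 # us @ b # vs)"
      "\<phi> (1 # us @ scale c a # vs) = c * \<phi> (1 # us @ a # vs)"
    using multi_slot_add[OF assms, of "1 # us" vs a b] multi_slot_scale[OF assms, of "1 # us" vs c a]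
    by simp_all
qed (simp add: multi_support[OF assms])

lemma rotation_period_multi: "\<phi> \<in> Multi k \<Longrightarrow> (cyclic_shift ^^ k) \<phi> = \<phi>"
  by (rule rotation_period) (simp add: multi_support)

section \<open>Relations between shift, norm and coboundaries\<close>

text \<open>
  With the faces written as conjugates \<open>\<rho>\<^sup>i d \<rho>\<^sup>-\<^sup>i\<close> of the first face, the relations
  between the shift and the coboundaries become manipulations of sums. The negative power is written
  \<open>\<rho>\<^sup>k\<^sup>-\<^sup>i\<close>, as the shift has order \<open>k\<close> on arity \<open>k\<close>.
\<close>

lemma bar_coboundary_conj:
  assumes "\<phi> \<in> Multi k" "k > 0"
  shows "bar_coboundary \<phi> = (\<Sum>i<k. (cyclic_shift ^^ i) (first_face ((cyclic_shift ^^ (k - i)) \<phi>)))"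
    (is "_ = ?S")
proof
  fix xs
  show "bar_coboundary \<phi> xs = ?S xs"
  proof (cases "length xs = Suc k")
    case True
    then show ?thesis
      unfolding bar_coboundary_sum_faces sum_fun_apply
      by (intro sum.cong) (simp_all only: cyclic_shift_conj_first_face lessThan_iff, simp)
  next
    case False
    have "?S \<in> Multi (Suc k)"
      using assms by (intro multi_sum multi_cyclic_shift_funpow multi_first_face) auto
    moreover have "bar_coboundary \<phi> xs = 0"
      unfolding bar_coboundary_sum_faces
      by (rule sum.neutral) (use False in \<open>auto simp: multi_support[OF assms(1)] nth_append\<close>)
    ultimately show ?thesis by (simp only: multi_support[OF _ False])
  qed
qed

lemma multi_bar_coboundary:
  assumes "\<phi> \<in> Multi k" "k > 0"
  shows "bar_coboundary \<phi> \<in> Multi (Suc k)"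
  unfolding bar_coboundary_conj[OF assms]
  by (intro multi_sum multi_cyclic_shift_funpow multi_first_face assms)

text \<open>
  The face that multiplies the last entry into the first is the first face seen after a full rotation
  but one step.
\<close>

lemma hochschild_coboundary_conv_first_face:
  assumes "\<phi> \<in> Multi (Suc n)"
  shows "hochschild_coboundary n \<phi> = bar_coboundary \<phi> + (cyclic_shift ^^ Suc n) (first_face \<phi>)"
proof
  fix xs
  show "hochschild_coboundary n \<phi> xs = (bar_coboundary \<phi> + (cyclic_shift ^^ Suc n) (first_face \<phi>)) xs"
  proof (cases "length xs = n + 2")
    case True
    then obtain x ys z where xs: "xs = x # ys @ [z]" "length ys = n" by (rule list_end_cases)
    have "rotate (Suc n) ((x # ys) @ [z]) = [z] @ x # ys"
      by (metis xs(2) length_Cons rotate_append)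
    then show ?thesis
      using xs by (simp add: hochschild_coboundary_conv_bar cyclic_shift_power first_face_def minus_one_power_iff
          del: rotate_Suc funpow.simps)
  next
    case False
    have "bar_coboundary \<phi> + (cyclic_shift ^^ Suc n) (first_face \<phi>) \<in> Multi (n + 2)"
      using multi_add[OF multi_bar_coboundary[OF assms] multi_cyclic_shift_funpow[OF multi_first_face[OF assms]], of "Suc n"]
      by (simp del: funpow.simps)
    then have "(bar_coboundary \<phi> + (cyclic_shift ^^ Suc n) (first_face \<phi>)) xs = 0"
      by (rule multi_support) (rule False)
    with hochschild_coboundary_wrong_length[OF False] show ?thesis by simp
  qed
qed

lemma hochschild_coboundary_conj:
  assumes "\<phi> \<in> Multi (Suc n)"
  shows "hochschild_coboundary n \<phi> =
    (\<Sum>i<Suc (Suc n). (cyclic_shift ^^ i) (first_face ((cyclic_shift ^^ (Suc n - i)) \<phi>)))"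
proof -
  let ?g = "\<lambda>i. (cyclic_shift ^^ i) (first_face ((cyclic_shift ^^ (Suc n - i)) \<phi>))"
  have "(\<Sum>i<Suc (Suc n). ?g i) = (\<Sum>i<Suc n. ?g i) + ?g (Suc n)"
    by (rule sum.lessThan_Suc)
  also have "?g (Suc n) = (cyclic_shift ^^ Suc n) (first_face \<phi>)"
    by (simp only: diff_self_eq_0 funpow_0)
  finally show ?thesis
    by (simp only: hochschild_coboundary_conv_first_face[OF assms] bar_coboundary_conj[OF assms zero_less_Suc])
qed

lemma multi_hochschild_coboundary:
  assumes "\<phi> \<in> Multi (Suc n)"
  shows "hochschild_coboundary n \<phi> \<in> Multi (Suc (Suc n))"
  unfolding hochschild_coboundary_conv_first_face[OF assms]
  by (intro multi_add multi_bar_coboundary multi_cyclic_shift_funpow multi_first_face assms zero_less_Suc)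

text \<open>
  This is \<open>(1 - \<lambda>) b = b' (1 - \<lambda>)\<close> for \<open>\<lambda> = \<rho>\<^sup>-\<^sup>1\<close>, cleared of
  inverses: applying \<open>\<rho>\<close> on the left moves the index of each conjugated face by one, and
  only the face at the end of the range is left over.
\<close>

lemma cyclic_shift_coboundary:
  assumes "\<psi> \<in> Multi (Suc n)"
  shows "cyclic_shift (hochschild_coboundary n (cyclic_shift \<psi>)) - hochschild_coboundary n (cyclic_shift \<psi>) =
    cyclic_shift (bar_coboundary (cyclic_shift \<psi> - \<psi>))"
proof -
  let ?r = cyclic_shift and ?d = first_face and ?k = "Suc n"
  note M = multi_cyclic_shift[OF assms]
  have d: "?d (?r \<psi>) \<in> Multi (Suc ?k)" using M by (simp add: multi_first_face)
  have 1: "hochschild_coboundary n (?r \<psi>) = bar_coboundary (?r \<psi>) + (?r ^^ ?k) (?d (?r \<psi>))"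
    by (rule hochschild_coboundary_conv_first_face[OF M])
  have "?r ((?r ^^ ?k) (?d (?r \<psi>))) = ?d (?r \<psi>)"
    using rotation_period_multi[OF d] by simp
  with 1 have 2: "?r (hochschild_coboundary n (?r \<psi>)) = ?r (bar_coboundary (?r \<psi>)) + ?d (?r \<psi>)"
    by (simp only: cyclic_shift_add)
  have "hochschild_coboundary n (?r \<psi>) =
      (\<Sum>i<Suc ?k. (?r ^^ i) (?d ((?r ^^ (?k - i)) (?r \<psi>))))"
    by (rule hochschild_coboundary_conj[OF M])
  also have "\<dots> = ?d ((?r ^^ ?k) (?r \<psi>)) + (\<Sum>i<?k. (?r ^^ Suc i) (?d ((?r ^^ (?k - Suc i)) (?r \<psi>))))"
    by (subst sum.lessThan_Suc_shift) (simp only: funpow_0 diff_zero)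
  also have "(?r ^^ ?k) (?r \<psi>) = ?r \<psi>"
    by (rule rotation_period_multi[OF M])
  also have "(\<Sum>i<?k. (?r ^^ Suc i) (?d ((?r ^^ (?k - Suc i)) (?r \<psi>)))) = ?r (bar_coboundary \<psi>)"
    unfolding bar_coboundary_conj[OF assms zero_less_Suc] cyclic_shift_sum
  proof (rule sum.cong[OF refl])
    fix i assume "i \<in> {..<?k}"
    then have "(?r ^^ (?k - Suc i)) (?r \<psi>) = (?r ^^ (?k - i)) \<psi>"
      by (simp add: Suc_diff_le funpow_swap1)
    then show "(?r ^^ Suc i) (?d ((?r ^^ (?k - Suc i)) (?r \<psi>))) = ?r ((?r ^^ i) (?d ((?r ^^ (?k - i)) \<psi>)))"
      by simp
  qed
  finally have "hochschild_coboundary n (?r \<psi>) = ?d (?r \<psi>) + ?r (bar_coboundary \<psi>)" .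
  from arg_cong[OF this, of "\<lambda>\<theta>. ?r (hochschild_coboundary n (?r \<psi>)) - \<theta>"] show ?thesis
    by (simp add: 2 bar_coboundary_diff_fun cyclic_shift_diff del: plus_fun_apply minus_apply)
qed

lemma multi_cyclic_norm: "\<phi> \<in> Multi k \<Longrightarrow> cyclic_norm m \<phi> \<in> Multi k"
  unfolding cyclic_norm_def by (intro multi_sum multi_cyclic_shift_funpow)

lemma cyclic_norm_shift:
  assumes "\<phi> \<in> Multi k"
  shows "cyclic_norm k (cyclic_shift \<phi>) = cyclic_norm k \<phi>"
proof (cases k)
  case (Suc m)
  have "cyclic_norm k (cyclic_shift \<phi>) = (\<Sum>i<Suc m. (cyclic_shift ^^ Suc i) \<phi>)"
    by (simp add: cyclic_norm_def Suc funpow_swap1 del: sum.lessThan_Suc)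
  also have "\<dots> = (\<Sum>i<m. (cyclic_shift ^^ Suc i) \<phi>) + \<phi>"
    using rotation_period_multi[OF assms] Suc by simp
  also have "\<dots> = cyclic_norm k \<phi>"
    unfolding cyclic_norm_def Suc by (subst sum.lessThan_Suc_shift) (simp add: add.commute)
  finally show ?thesis .
qed (simp add: cyclic_norm_def)

lemma cyclic_norm_shift_funpow:
  "\<phi> \<in> Multi k \<Longrightarrow> cyclic_norm k ((cyclic_shift ^^ m) \<phi>) = cyclic_norm k \<phi>"
  by (induction m) (simp_all add: cyclic_norm_shift multi_cyclic_shift_funpow)

lemma shift_cyclic_norm:
  assumes "\<phi> \<in> Multi k"
  shows "cyclic_shift (cyclic_norm k \<phi>) = cyclic_norm k \<phi>"
  using cyclic_norm_shift[OF assms]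
  by (simp add: cyclic_norm_def cyclic_shift_sum funpow_swap1)

lemma cyclic_norm_diff: "cyclic_norm k (\<phi> - \<psi>) = cyclic_norm k \<phi> - cyclic_norm k \<psi>"
  by (simp add: cyclic_norm_def cyclic_shift_funpow_diff sum_subtractf)

lemma cyclic_norm_sum: "cyclic_norm k (\<Sum>i\<in>A. \<phi> i) = (\<Sum>i\<in>A. cyclic_norm k (\<phi> i))"
proof (induction A rule: infinite_finite_induct)
  have z: "cyclic_norm k 0 = (0 :: 'b list \<Rightarrow> complex)"
    using cyclic_norm_diff[of k 0 0] by simp
  { case (infinite A) with z show ?case by (simp del: zero_fun_apply) }
  { case empty with z show ?case by (simp del: zero_fun_apply) }
  case (insert x A)
  have "cyclic_norm k (\<phi> x + sum \<phi> A) = cyclic_norm k (\<phi> x) + cyclic_norm k (sum \<phi> A)"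
    by (simp add: cyclic_norm_def cyclic_shift_funpow_add sum.distrib)
  with insert show ?case by (simp del: plus_fun_apply)
qed

text \<open>
  Both sides equal \<open>N d N\<close>: on the left the outer norm absorbs the powers of the shift to
  the left of \<open>d\<close> and the powers to the right of it add up to the inner norm; on the right
  the inner norm absorbs the powers to the right.
\<close>

lemma cyclic_norm_coboundary:
  assumes "\<phi> \<in> Multi (Suc n)"
  shows "cyclic_norm (Suc (Suc n)) (bar_coboundary \<phi>) = hochschild_coboundary n (cyclic_norm (Suc n) \<phi>)"
proof -
  let ?r = cyclic_shift and ?d = first_face and ?k = "Suc n" and ?N = "cyclic_norm (Suc n) \<phi>"
  have "cyclic_norm (Suc ?k) (bar_coboundary \<phi>) =
      (\<Sum>i<?k. cyclic_norm (Suc ?k) (?d ((?r ^^ (?k - i)) \<phi>)))"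
    unfolding bar_coboundary_conj[OF assms zero_less_Suc] cyclic_norm_sum
    by (intro sum.cong refl cyclic_norm_shift_funpow multi_first_face multi_cyclic_shift_funpow assms zero_less_Suc)
  also have "\<dots> = cyclic_norm (Suc ?k) (?d (\<Sum>i<?k. (?r ^^ (?k - i)) \<phi>))"
    by (simp only: cyclic_norm_sum first_face_sum)
  also have "(\<Sum>i<?k. (?r ^^ (?k - i)) \<phi>) = cyclic_norm ?k (?r \<phi>)"
    unfolding cyclic_norm_def
  proof (rule sum.reindex_bij_witness[of _ "\<lambda>i. n - i" "\<lambda>i. n - i"])
    fix i assume "i \<in> {..<?k}"
    then show "(?r ^^ (n - i)) (?r \<phi>) = (?r ^^ (?k - i)) \<phi>"
      by (simp add: Suc_diff_le funpow_swap1)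
  qed auto
  also have "\<dots> = ?N" by (rule cyclic_norm_shift[OF assms])
  also have "cyclic_norm (Suc ?k) (?d ?N) = hochschild_coboundary n ?N"
    unfolding hochschild_coboundary_conj[OF multi_cyclic_norm[OF assms]] cyclic_norm_def[of "Suc ?k"]
    by (simp only: cyclic_shift_funpow_fixed[OF shift_cyclic_norm[OF assms]])
  finally show ?thesis .
qed

lemma cyclic_norm_fixed:
  assumes "cyclic_shift \<phi> = \<phi>"
  shows "cyclic_norm k \<phi> = (\<lambda>xs. of_nat k * \<phi> xs)"
  by (simp add: fun_eq_iff cyclic_norm_def sum_fun_apply cyclic_shift_funpow_fixed[OF assms])

text \<open>
  On the kernel of the norm, \<open>\<phi>\<close> is the mean of the differences
  \<open>\<phi> - \<rho>\<^sup>i \<phi>\<close>, and each of them telescopes into a multiple of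
  \<open>\<rho> - 1\<close>.
\<close>

lemma cyclic_norm_kernel:
  assumes "\<phi> \<in> Multi k" "k > 0" "cyclic_norm k \<phi> = 0"
  shows "\<exists>\<mu>\<in>Multi k. \<phi> = cyclic_shift \<mu> - \<mu>"
proof
  let ?r = cyclic_shift
  \<comment> \<open>The inner sum is the telescoping solution for \<open>\<rho>\<^sup>i \<phi> - \<phi>\<close>.\<close>
  define \<nu> where "\<nu> = (\<Sum>i<k. \<Sum>j<i. (?r ^^ j) \<phi>)"
  let ?\<mu> = "\<lambda>xs. (- 1 / of_nat k) * \<nu> xs"
  have \<nu>: "\<nu> \<in> Multi k" unfolding \<nu>_def by (intro multi_sum multi_cyclic_shift_funpow assms)
  then show "?\<mu> \<in> Multi k" by (rule multi_scale)
  have "?r \<nu> - \<nu> = (\<Sum>i<k. \<Sum>j<i. (?r ^^ Suc j) \<phi> - (?r ^^ j) \<phi>)"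
    by (simp add: \<nu>_def cyclic_shift_sum sum_subtractf)
  also have "\<dots> = (\<Sum>i<k. (?r ^^ i) \<phi> - \<phi>)"
    using sum_lessThan_telescope[of "\<lambda>j. (?r ^^ j) \<phi>"] by (simp del: minus_apply funpow.simps(2))
  also have "\<dots> = cyclic_norm k \<phi> - (\<Sum>i<k. \<phi>)" by (simp add: cyclic_norm_def sum_subtractf)
  also have "\<dots> = - (\<lambda>xs. of_nat k * \<phi> xs)" by (simp add: assms(3) fun_eq_iff sum_fun_apply)
  finally have "?r \<nu> xs - \<nu> xs = - (of_nat k * \<phi> xs)" for xs by (simp add: fun_eq_iff)
  then show "\<phi> = ?r ?\<mu> - ?\<mu>"
    using assms(2) by (simp only: cyclic_shift_scale) (simp add: fun_eq_iff field_simps)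
qed

lemma bar_exact:
  assumes "\<phi> \<in> Multi (Suc (Suc n))" "bar_coboundary \<phi> = 0"
  shows "\<exists>\<alpha>\<in>Multi (Suc n). \<phi> = bar_coboundary \<alpha>"
proof
  show \<alpha>: "(\<lambda>xs. \<phi> (1 # xs)) \<in> Multi (Suc n)" using assms(1) by (rule multi_insert_unit)
  show "\<phi> = bar_coboundary (\<lambda>xs. \<phi> (1 # xs))"
  proof
    fix xs show "\<phi> xs = bar_coboundary (\<lambda>xs. \<phi> (1 # xs)) xs"
      using multi_support[OF assms(1), of xs] bar_coboundary_unit[of xs \<phi>] assms(2)
      by (cases "xs = []") simp_all
  qed
qed

end

section \<open>Values at idempotents\<close>

text \<open>
  At \<open>(p, \<dots>, p)\<close> all faces have the same value, so an alternating sum of them is that value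
  or zero.
\<close>

lemma bar_coboundary_replicate:
  assumes "p * p = p"
  shows "bar_coboundary \<phi> (replicate (Suc (Suc n)) p) = (if even n then \<phi> (replicate (Suc n) p) else 0)"
proof (induction n arbitrary: \<phi>)
  case (Suc n)
  show ?case
    using Suc[of "\<lambda>ws. \<phi> (p # ws)"] assms by auto
qed (simp add: assms)

lemma hochschild_coboundary_replicate:
  assumes "p * p = p"
  shows "hochschild_coboundary n \<phi> (replicate (n + 2) p) = (if even n then 0 else \<phi> (replicate (Suc n) p))"
proof -
  have r: "replicate (n + 2) p = p # replicate n p @ [p]"
    by (simp add: replicate_append_same)
  have "bar_coboundary \<phi> (p # replicate n p @ [p]) = (if even n then \<phi> (replicate (Suc n) p) else 0)"
    using bar_coboundary_replicate[OF assms, of \<phi> n] by (simp add: replicate_append_same)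
  then show ?thesis
    unfolding r by (subst hochschild_coboundary_conv_bar) (simp_all add: assms)
qed

lemma cyclic_norm_replicate:
  assumes "odd k"
  shows "cyclic_norm k \<phi> (replicate k p) = of_nat k * \<phi> (replicate k p)"
proof -
  have "rotate i (replicate k p) = replicate k p" for i
    by (induction i) (simp_all add: rotate1_replicate rotate_Suc)
  then have "cyclic_norm k \<phi> (replicate k p) = (\<Sum>i<k. \<phi> (replicate k p))"
    using assms by (simp add: cyclic_norm_def sum_fun_apply cyclic_shift_power minus_one_power_iff)
  then show ?thesis by simp
qed

section \<open>Connes periodicity\<close>

context complex_algebra
begin

abbreviation Z :: "nat \<Rightarrow> ('a list \<Rightarrow> complex) set" where "Z \<equiv> cyclic_cocycles scale"
abbreviation B :: "nat \<Rightarrow> ('a list \<Rightarrow> complex) set" where "B \<equiv> cyclic_coboundaries scale"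

lemma cyclic_cochains_iff: "\<phi> \<in> Cyc n \<longleftrightarrow> \<phi> \<in> Multi (Suc n) \<and> cyclic_shift \<phi> = \<phi>"
proof -
  have "(\<forall>xs. length xs = n + 1 \<longrightarrow> \<phi> (rotate1 xs) = (- 1) ^ n * \<phi> xs) \<longleftrightarrow> cyclic_shift \<phi> = \<phi>"
    if "\<phi> \<in> Multi (Suc n)"
  proof -
    have "(length xs = n + 1 \<longrightarrow> \<phi> (rotate1 xs) = (- 1) ^ n * \<phi> xs) \<longleftrightarrow> cyclic_shift \<phi> xs = \<phi> xs" for xs
      using multi_support[OF that, of xs] multi_support[OF that, of "rotate1 xs"]
      by (cases "length xs = n + 1")
        (auto simp: cyclic_shift_def minus_one_power_iff neg_eq_iff_add_eq_0 eq_neg_iff_add_eq_0 algebra_simps)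
    then show ?thesis by (simp add: fun_eq_iff)
  qed
  then show ?thesis by (auto simp: cyclic_cochains_def)
qed

lemma cyclic_cocycles_iff: "\<phi> \<in> Z n \<longleftrightarrow> \<phi> \<in> Cyc n \<and> hochschild_coboundary n \<phi> = 0"
  by (simp add: cyclic_cocycles_def zero_fun_def)

lemma cyclic_coboundaries_0: "B 0 = {0}"
  by (simp add: cyclic_coboundaries_def zero_fun_def)

lemma cyclic_coboundaries_Suc: "B (Suc m) = hochschild_coboundary m ` Cyc m"
  by (simp add: cyclic_coboundaries_def)

lemma Cyc_zero: "0 \<in> Cyc n" and Cyc_add: "\<phi> \<in> Cyc n \<Longrightarrow> \<psi> \<in> Cyc n \<Longrightarrow> \<phi> + \<psi> \<in> Cyc n"
  and Cyc_diff: "\<phi> \<in> Cyc n \<Longrightarrow> \<psi> \<in> Cyc n \<Longrightarrow> \<phi> - \<psi> \<in> Cyc n"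
  and Cyc_scale: "\<phi> \<in> Cyc n \<Longrightarrow> (\<lambda>xs. c * \<phi> xs) \<in> Cyc n"
  by (simp_all add: cyclic_cochains_iff multi_zero multi_add multi_diff multi_scale cyclic_shift_zero
      cyclic_shift_add cyclic_shift_diff cyclic_shift_scale del: plus_fun_apply minus_apply)

lemma Z_zero: "0 \<in> Z n" and Z_add: "\<phi> \<in> Z n \<Longrightarrow> \<psi> \<in> Z n \<Longrightarrow> \<phi> + \<psi> \<in> Z n"
  and Z_diff: "\<phi> \<in> Z n \<Longrightarrow> \<psi> \<in> Z n \<Longrightarrow> \<phi> - \<psi> \<in> Z n"
  by (auto simp add: cyclic_cocycles_iff Cyc_zero Cyc_add Cyc_diff hochschild_coboundary_zero
      hochschild_coboundary_add hochschild_coboundary_diff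
      simp del: plus_fun_apply minus_apply zero_fun_apply)

lemma Z_scale: "\<phi> \<in> Z n \<Longrightarrow> (\<lambda>xs. c * \<phi> xs) \<in> Z n"
  by (simp add: cyclic_cocycles_iff Cyc_scale hochschild_coboundary_scale) (simp add: fun_eq_iff)

lemma B_zero: "0 \<in> B n"
  using Cyc_zero by (cases n) (force simp: cyclic_coboundaries_0 cyclic_coboundaries_Suc hochschild_coboundary_zero
    simp del: zero_fun_apply)+

lemma B_scale: "\<phi> \<in> B n \<Longrightarrow> (\<lambda>xs. c * \<phi> xs) \<in> B n"
  by (cases n) (auto simp: cyclic_coboundaries_0 cyclic_coboundaries_Suc zero_fun_def
      simp flip: hochschild_coboundary_scale intro!: imageI Cyc_scale)

lemma B_add: "\<phi> \<in> B n \<Longrightarrow> \<psi> \<in> B n \<Longrightarrow> \<phi> + \<psi> \<in> B n"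
  by (cases n) (auto simp: cyclic_coboundaries_0 cyclic_coboundaries_Suc simp del: plus_fun_apply
      simp flip: hochschild_coboundary_add intro!: imageI Cyc_add)

lemma hochschild_coboundary_cyclic:
  assumes "\<phi> \<in> Cyc n"
  shows "hochschild_coboundary n \<phi> \<in> Cyc (Suc n)"
proof -
  have M: "\<phi> \<in> Multi (Suc n)" and r: "cyclic_shift \<phi> = \<phi>"
    using assms by (simp_all add: cyclic_cochains_iff)
  have "cyclic_shift (hochschild_coboundary n \<phi>) - hochschild_coboundary n \<phi> = 0"
    using cyclic_shift_coboundary[OF M]
    by (simp add: r bar_coboundary_zero_fun cyclic_shift_zero del: minus_apply)
  then show ?thesis
    using multi_hochschild_coboundary[OF M] by (simp add: cyclic_cochains_iff del: minus_apply)
qed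

lemma B_subset_Z: "B n \<subseteq> Z n"
  by (cases n) (auto simp: cyclic_coboundaries_0 Cyc_zero hochschild_coboundary_zero cyclic_coboundaries_Suc cyclic_cocycles_iff
      hochschild_coboundary_cyclic hochschild_coboundary_square_fun simp del: zero_fun_apply)

text \<open>
  The relation behind Connes' periodicity operator. If \<open>\<alpha>\<close> and \<open>\<beta>\<close> form
  a zigzag, then \<open>N \<alpha>\<close> is a cyclic cocycle of degree \<open>n\<close> and
  \<open>b \<rho> \<beta>\<close> is one of degree \<open>n + 2\<close>. Passing between the two by a relation
  avoids choosing \<open>\<alpha>\<close> and \<open>\<beta>\<close>.
\<close>

definition zigzag :: "nat \<Rightarrow> ('a list \<Rightarrow> complex) \<Rightarrow> ('a list \<Rightarrow> complex) \<Rightarrow> bool"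
  where "zigzag n \<alpha> \<beta> \<longleftrightarrow> \<alpha> \<in> Multi (Suc n) \<and> \<beta> \<in> Multi (Suc (Suc n)) \<and>
    bar_coboundary \<alpha> = cyclic_shift \<beta> - \<beta>"

lemma zigzag_cocycle:
  assumes "zigzag n \<alpha> \<beta>"
  shows "hochschild_coboundary (Suc n) (cyclic_shift \<beta>) \<in> Z (Suc (Suc n))"
proof -
  have M: "\<beta> \<in> Multi (Suc (Suc n))" and e: "bar_coboundary \<alpha> = cyclic_shift \<beta> - \<beta>"
    using assms by (simp_all add: zigzag_def)
  let ?\<phi> = "hochschild_coboundary (Suc n) (cyclic_shift \<beta>)"
  have "?\<phi> \<in> Multi (Suc (Suc (Suc n)))"
    by (intro multi_hochschild_coboundary multi_cyclic_shift M)
  moreover have "cyclic_shift ?\<phi> - ?\<phi> = 0"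
    unfolding cyclic_shift_coboundary[OF M] e[symmetric] bar_coboundary_square_fun cyclic_shift_zero ..
  ultimately show ?thesis
    by (simp add: cyclic_cocycles_iff cyclic_cochains_iff hochschild_coboundary_square_fun del: minus_apply)
qed

lemma zigzag_exists:
  assumes "\<omega> \<in> Z n"
  shows "\<exists>\<alpha> \<beta>. zigzag n \<alpha> \<beta> \<and> cyclic_norm (Suc n) \<alpha> = \<omega>"
proof -
  have M: "\<omega> \<in> Multi (Suc n)" and r: "cyclic_shift \<omega> = \<omega>" and c: "hochschild_coboundary n \<omega> = 0"
    using assms by (simp_all add: cyclic_cocycles_iff cyclic_cochains_iff)
  define \<alpha> where "\<alpha> = (\<lambda>xs. (1 / of_nat (Suc n)) * \<omega> xs)"
  have \<alpha>: "\<alpha> \<in> Multi (Suc n)" unfolding \<alpha>_def by (rule multi_scale[OF M])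
  have "cyclic_shift \<alpha> = \<alpha>" unfolding \<alpha>_def cyclic_shift_scale r ..
  then have N: "cyclic_norm (Suc n) \<alpha> = \<omega>"
    unfolding cyclic_norm_fixed[OF \<open>cyclic_shift \<alpha> = \<alpha>\<close>]
    by (simp add: \<alpha>_def fun_eq_iff field_simps del: of_nat_Suc)
  have "cyclic_norm (Suc (Suc n)) (bar_coboundary \<alpha>) = 0"
    by (simp only: cyclic_norm_coboundary[OF \<alpha>] N c)
  then obtain \<beta> where "\<beta> \<in> Multi (Suc (Suc n))" "bar_coboundary \<alpha> = cyclic_shift \<beta> - \<beta>"
    using cyclic_norm_kernel[OF multi_bar_coboundary[OF \<alpha>]] by blast
  with \<alpha> N show ?thesis unfolding zigzag_def by blast
qed

text \<open>
  Read backwards: if \<open>b \<rho> \<beta>\<close> is cyclic, then \<open>(\<rho> - 1) \<beta>\<close> is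
  annihilated by \<open>b'\<close>, hence of the form \<open>b' \<alpha>\<close>. So a cyclic cocycle
  comes from one of degree two less as soon as it is a Hochschild coboundary.
\<close>

lemma zigzag_surjective:
  assumes "\<phi> \<in> Z (Suc (Suc n))" "\<gamma> \<in> Multi (Suc (Suc n))" "\<phi> = hochschild_coboundary (Suc n) \<gamma>"
  shows "\<exists>\<alpha> \<beta>. zigzag n \<alpha> \<beta> \<and> cyclic_norm (Suc n) \<alpha> \<in> Z n \<and>
    \<phi> = hochschild_coboundary (Suc n) (cyclic_shift \<beta>)"
proof -
  define \<beta> where "\<beta> = (cyclic_shift ^^ Suc n) \<gamma>"
  have \<beta>: "\<beta> \<in> Multi (Suc (Suc n))"
    unfolding \<beta>_def by (intro multi_cyclic_shift_funpow assms)
  have r\<beta>: "cyclic_shift \<beta> = \<gamma>"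
    using rotation_period_multi[OF assms(2)] by (simp add: \<beta>_def)
  have b: "bar_coboundary (cyclic_shift \<beta> - \<beta>) \<in> Multi (Suc (Suc (Suc n)))"
    by (intro multi_bar_coboundary multi_diff multi_cyclic_shift \<beta> zero_less_Suc)
  have "cyclic_shift \<phi> = \<phi>" using assms(1) by (simp add: cyclic_cocycles_iff cyclic_cochains_iff)
  then have "cyclic_shift (bar_coboundary (cyclic_shift \<beta> - \<beta>)) = 0"
    using cyclic_shift_coboundary[OF \<beta>] r\<beta> assms(3) by (simp del: minus_apply)
  then have "(cyclic_shift ^^ Suc (Suc (Suc n))) (bar_coboundary (cyclic_shift \<beta> - \<beta>)) = 0"
    by (simp only: funpow_Suc_right o_apply) (simp add: cyclic_shift_zero cyclic_shift_funpow_fixed del: zero_fun_apply)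
  then have "bar_coboundary (cyclic_shift \<beta> - \<beta>) = 0"
    by (simp only: rotation_period_multi[OF b])
  then obtain \<alpha> where \<alpha>: "\<alpha> \<in> Multi (Suc n)" "cyclic_shift \<beta> - \<beta> = bar_coboundary \<alpha>"
    using bar_exact multi_diff[OF multi_cyclic_shift[OF \<beta>] \<beta>] by blast
  have "hochschild_coboundary n (cyclic_norm (Suc n) \<alpha>) =
      cyclic_norm (Suc (Suc n)) (cyclic_shift \<beta>) - cyclic_norm (Suc (Suc n)) \<beta>"
    unfolding cyclic_norm_coboundary[OF \<alpha>(1), symmetric] \<alpha>(2)[symmetric] cyclic_norm_diff ..
  also have "\<dots> = 0" by (simp add: cyclic_norm_shift[OF \<beta>] del: minus_apply)
  finally have "cyclic_norm (Suc n) \<alpha> \<in> Z n"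
    using multi_cyclic_norm[OF \<alpha>(1)] shift_cyclic_norm[OF \<alpha>(1)]
    by (simp add: cyclic_cocycles_iff cyclic_cochains_iff)
  then show ?thesis
    using \<alpha> \<beta> r\<beta> assms(3) unfolding zigzag_def by metis
qed

text \<open>
  Two solutions \<open>\<rho> \<beta>\<close> and \<open>\<gamma>\<close> of the same equation differ by a
  cyclic cochain. So one solution that is a Hochschild cocycle makes
  \<open>b \<rho> \<beta>\<close> the coboundary of a cyclic cochain.
\<close>

lemma zigzag_coboundary_criterion:
  assumes "zigzag n \<alpha> \<beta>" "\<gamma> \<in> Multi (Suc (Suc n))" "hochschild_coboundary (Suc n) \<gamma> = 0"
    and "cyclic_shift (bar_coboundary \<alpha>) = cyclic_shift \<gamma> - \<gamma>"
  shows "hochschild_coboundary (Suc n) (cyclic_shift \<beta>) \<in> B (Suc (Suc n))"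
proof -
  have \<beta>: "\<beta> \<in> Multi (Suc (Suc n))" and e: "bar_coboundary \<alpha> = cyclic_shift \<beta> - \<beta>"
    using assms by (simp_all add: zigzag_def)
  have "cyclic_shift (cyclic_shift \<beta>) - cyclic_shift \<beta> = cyclic_shift \<gamma> - \<gamma>"
    using assms(4) by (simp only: e cyclic_shift_diff)
  then have "cyclic_shift (cyclic_shift \<beta> - \<gamma>) = cyclic_shift \<beta> - \<gamma>"
    unfolding cyclic_shift_diff by (simp add: algebra_simps del: minus_apply plus_fun_apply)
  then have "cyclic_shift \<beta> - \<gamma> \<in> Cyc (Suc n)"
    using \<beta> assms(2) by (simp add: cyclic_cochains_iff multi_diff multi_cyclic_shift del: minus_apply)
  moreover have "hochschild_coboundary (Suc n) (cyclic_shift \<beta>) =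
      hochschild_coboundary (Suc n) (cyclic_shift \<beta> - \<gamma>)"
    unfolding hochschild_coboundary_diff assms(3) by simp
  ultimately show ?thesis unfolding cyclic_coboundaries_Suc by blast
qed

text \<open>
  The periodicity operator is well defined on classes: if \<open>N \<alpha> = b \<eta>\<close> with
  \<open>\<eta> = N \<kappa>\<close>, then \<open>\<alpha>\<close> and \<open>b' \<kappa>\<close> have the same
  norm, so they differ by some \<open>(\<rho> - 1) \<mu>\<close>, and \<open>b \<rho> \<mu>\<close> is a
  Hochschild cocycle solving the equation for \<open>\<rho> \<beta>\<close>.
\<close>

lemma zigzag_coboundary:
  assumes "zigzag n \<alpha> \<beta>" "cyclic_norm (Suc n) \<alpha> \<in> B n"
  shows "hochschild_coboundary (Suc n) (cyclic_shift \<beta>) \<in> B (Suc (Suc n))"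
proof -
  have \<alpha>: "\<alpha> \<in> Multi (Suc n)" using assms(1) by (simp add: zigzag_def)
  have "\<exists>\<mu>\<in>Multi (Suc n). bar_coboundary \<alpha> = bar_coboundary (cyclic_shift \<mu> - \<mu>)"
  proof (cases n)
    case 0
    have "\<alpha> = 0" using assms(2) 0 by (simp add: cyclic_coboundaries_0 cyclic_norm_def)
    then show ?thesis
      by (intro bexI[of _ 0]) (simp_all add: multi_zero cyclic_shift_zero del: minus_apply zero_fun_apply)
  next
    case (Suc m)
    then obtain \<eta> where \<eta>: "\<eta> \<in> Cyc m" "cyclic_norm (Suc n) \<alpha> = hochschild_coboundary m \<eta>"
      using assms(2) by (auto simp: cyclic_coboundaries_Suc)
    define \<kappa> where "\<kappa> = (\<lambda>xs. (1 / of_nat n) * \<eta> xs)"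
    have \<kappa>: "\<kappa> \<in> Multi n" and "cyclic_shift \<kappa> = \<kappa>"
      using Cyc_scale[OF \<eta>(1), of "1 / of_nat n"] Suc by (simp_all add: \<kappa>_def cyclic_cochains_iff)
    then have N: "cyclic_norm n \<kappa> = \<eta>"
      unfolding cyclic_norm_fixed[OF \<open>cyclic_shift \<kappa> = \<kappa>\<close>] using Suc
      by (simp add: \<kappa>_def fun_eq_iff field_simps del: of_nat_Suc)
    have k: "bar_coboundary \<kappa> \<in> Multi (Suc n)" using \<kappa> Suc by (simp add: multi_bar_coboundary)
    have "cyclic_norm (Suc n) (\<alpha> - bar_coboundary \<kappa>) = 0"
      unfolding cyclic_norm_diff \<eta>(2) using cyclic_norm_coboundary[of \<kappa> m] \<kappa> N Suc
      by (simp del: minus_apply)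
    then obtain \<mu> where \<mu>: "\<mu> \<in> Multi (Suc n)" "\<alpha> - bar_coboundary \<kappa> = cyclic_shift \<mu> - \<mu>"
      using cyclic_norm_kernel[OF multi_diff[OF \<alpha> k]] by blast
    have "bar_coboundary (\<alpha> - bar_coboundary \<kappa>) = bar_coboundary \<alpha>"
      unfolding bar_coboundary_diff_fun bar_coboundary_square_fun by simp
    with \<mu> show ?thesis by metis
  qed
  then obtain \<mu> where \<mu>: "\<mu> \<in> Multi (Suc n)" "bar_coboundary \<alpha> = bar_coboundary (cyclic_shift \<mu> - \<mu>)"
    by blast
  show ?thesis
  proof (rule zigzag_coboundary_criterion[OF assms(1)])
    show "hochschild_coboundary n (cyclic_shift \<mu>) \<in> Multi (Suc (Suc n))"
      by (intro multi_hochschild_coboundary multi_cyclic_shift \<mu>)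
    show "hochschild_coboundary (Suc n) (hochschild_coboundary n (cyclic_shift \<mu>)) = 0"
      by (rule hochschild_coboundary_square_fun)
    show "cyclic_shift (bar_coboundary \<alpha>) = cyclic_shift (hochschild_coboundary n (cyclic_shift \<mu>))
        - hochschild_coboundary n (cyclic_shift \<mu>)"
      unfolding cyclic_shift_coboundary[OF \<mu>(1)] \<mu>(2) ..
  qed
qed

text \<open>
  The pairing with an idempotent is compatible with periodicity up to a nonzero factor: on constant
  lists \<open>\<rho> - 1\<close> is multiplication by \<open>-2\<close> in odd degree, and
  \<open>N\<close> is multiplication by \<open>n + 1\<close> in even degree.
\<close>

lemma zigzag_pairing:
  assumes "zigzag n \<alpha> \<beta>" "p * p = p" "even n"
  shows "cyclic_norm (Suc n) \<alpha> (replicate (Suc n) p) =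
    2 * of_nat (Suc n) * hochschild_coboundary (Suc n) (cyclic_shift \<beta>) (replicate (Suc (Suc (Suc n))) p)"
proof -
  have e: "bar_coboundary \<alpha> = cyclic_shift \<beta> - \<beta>" using assms by (simp add: zigzag_def)
  have s: "cyclic_shift \<beta> (replicate (Suc (Suc n)) p) = - \<beta> (replicate (Suc (Suc n)) p)"
    using assms(3) by (simp add: cyclic_shift_def rotate1_replicate minus_one_power_iff replicate_append_same)
  have "hochschild_coboundary (Suc n) (cyclic_shift \<beta>) (replicate (Suc n + 2) p) =
      cyclic_shift \<beta> (replicate (Suc (Suc n)) p)"
    using hochschild_coboundary_replicate[OF assms(2), of "Suc n" "cyclic_shift \<beta>"] assms(3) by simp
  moreover have "\<alpha> (replicate (Suc n) p) = - 2 * \<beta> (replicate (Suc (Suc n)) p)"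
    using bar_coboundary_replicate[OF assms(2), of \<alpha> n] assms(3) s by (simp add: e)
  moreover have "cyclic_norm (Suc n) \<alpha> (replicate (Suc n) p) = of_nat (Suc n) * \<alpha> (replicate (Suc n) p)"
    using assms(3) by (intro cyclic_norm_replicate) simp
  ultimately show ?thesis using s by (simp add: algebra_simps)
qed

text \<open>
  A cyclic cochain of odd degree changes sign under the rotation of \<open>(p, \<dots>, p)\<close>, which does
  not move the list.
\<close>

lemma coboundary_pairing:
  assumes "\<phi> \<in> B n" "p * p = p" "even n"
  shows "\<phi> (replicate (Suc n) p) = 0"
proof (cases n)
  case 0
  then show ?thesis using assms by (simp add: cyclic_coboundaries_0)
next
  case (Suc m)
  then obtain \<eta> where \<eta>: "\<eta> \<in> Cyc m" "\<phi> = hochschild_coboundary m \<eta>"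
    using assms by (auto simp: cyclic_coboundaries_Suc)
  have "cyclic_shift \<eta> (replicate n p) = \<eta> (replicate n p)"
    using \<eta>(1) by (simp add: cyclic_cochains_iff)
  then have "\<eta> (replicate n p) = 0"
    using assms(3) by (simp add: cyclic_shift_def rotate1_replicate minus_one_power_iff split: if_splits)
  then show ?thesis
    using hochschild_coboundary_replicate[OF assms(2), of m \<eta>] assms(3) Suc \<eta>(2) by simp
qed

section \<open>Cyclic cocycles when Hochschild cohomology vanishes above degree one\<close>

lemma odd_cyclic_cocycles_exact:
  assumes hh: "\<And>n \<phi>. \<phi> \<in> Multi (n + 3) \<Longrightarrow> hochschild_coboundary (n + 2) \<phi> = 0 \<Longrightarrow>
      \<exists>\<psi>\<in>Multi (n + 2). \<phi> = hochschild_coboundary (n + 1) \<psi>"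
    and base: "Z 1 \<subseteq> B 1"
  shows "odd n \<Longrightarrow> Z n \<subseteq> B n"
proof (induction n rule: less_induct)
  case (less n)
  show ?case
  proof (cases "n = 1")
    case False
    with less.prems obtain m where n: "n = Suc (Suc m)" "odd m"
      by (cases n; cases "n - 1") auto
    show ?thesis
    proof
      fix \<phi> assume \<phi>: "\<phi> \<in> Z n"
      then have "\<phi> \<in> Multi (m + 3)" "hochschild_coboundary (m + 2) \<phi> = 0"
        using n by (simp_all add: cyclic_cocycles_iff cyclic_cochains_iff numeral_3_eq_3)
      then obtain \<gamma> where "\<gamma> \<in> Multi (Suc (Suc m))" "\<phi> = hochschild_coboundary (Suc m) \<gamma>"
        using hh by fastforce
      then obtain \<alpha> \<beta> where "zigzag m \<alpha> \<beta>" "cyclic_norm (Suc m) \<alpha> \<in> Z m"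
          "\<phi> = hochschild_coboundary (Suc m) (cyclic_shift \<beta>)"
        using zigzag_surjective \<phi> n by blast
      then show "\<phi> \<in> B n" using zigzag_coboundary less.IH[of m] n by auto
    qed
  qed (use base in simp)
qed

text \<open>
  Descend along zigzags to degree 0. The values at the idempotents survive the descent up to nonzero
  factors, so the trace reached at the end vanishes on all of them. By the last assumption such a
  trace \<open>\<omega>\<close> satisfies \<open>b' \<omega> = \<gamma> - \<rho> \<gamma>\<close> for a Hochschild 1-cocycle
  \<open>\<gamma>\<close>, and \<open>zigzag_coboundary_criterion\<close> kills it in degree 2.
\<close>

lemma even_cyclic_cocycles_exact:
  assumes hh: "\<And>n \<phi>. \<phi> \<in> Multi (n + 3) \<Longrightarrow> hochschild_coboundary (n + 2) \<phi> = 0 \<Longrightarrow>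
      \<exists>\<psi>\<in>Multi (n + 2). \<phi> = hochschild_coboundary (n + 1) \<psi>"
    and idem: "\<And>i. i \<in> I \<Longrightarrow> p i * p i = p i"
    and base: "\<And>\<omega>. \<omega> \<in> Z 0 \<Longrightarrow> (\<And>i. i \<in> I \<Longrightarrow> \<omega> [p i] = 0) \<Longrightarrow>
      \<exists>\<gamma>\<in>Multi 2. hochschild_coboundary 1 \<gamma> = 0 \<and> \<gamma> - cyclic_shift \<gamma> = bar_coboundary \<omega>"
  shows "even n \<Longrightarrow> \<phi> \<in> Z (Suc (Suc n)) \<Longrightarrow>
    (\<And>i. i \<in> I \<Longrightarrow> \<phi> (replicate (Suc (Suc (Suc n))) (p i)) = 0) \<Longrightarrow> \<phi> \<in> B (Suc (Suc n))"
proof (induction n arbitrary: \<phi> rule: less_induct)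
  case (less n)
  have "\<phi> \<in> Multi (n + 3)" "hochschild_coboundary (n + 2) \<phi> = 0"
    using less.prems by (simp_all add: cyclic_cocycles_iff cyclic_cochains_iff numeral_3_eq_3)
  then obtain \<gamma> where "\<gamma> \<in> Multi (Suc (Suc n))" "\<phi> = hochschild_coboundary (Suc n) \<gamma>"
    using hh by fastforce
  then obtain \<alpha> \<beta> where z: "zigzag n \<alpha> \<beta>" and \<omega>: "cyclic_norm (Suc n) \<alpha> \<in> Z n"
      and \<phi>: "\<phi> = hochschild_coboundary (Suc n) (cyclic_shift \<beta>)"
    using zigzag_surjective less.prems(2) by blast
  have 0: "cyclic_norm (Suc n) \<alpha> (replicate (Suc n) (p i)) = 0" if "i \<in> I" for i
    using zigzag_pairing[OF z idem[OF that] less.prems(1)] less.prems(3)[OF that] \<phi> by simp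
  show ?case
  proof (cases "n = 0")
    case True
    then have N: "cyclic_norm (Suc n) \<alpha> = \<alpha>" by (simp add: cyclic_norm_def)
    then obtain \<gamma> where \<gamma>: "\<gamma> \<in> Multi 2" "hochschild_coboundary 1 \<gamma> = 0"
        "\<gamma> - cyclic_shift \<gamma> = bar_coboundary \<alpha>"
      using base[of \<alpha>] \<omega> 0 True by auto
    have r: "cyclic_shift (cyclic_shift \<gamma>) = \<gamma>"
      using rotation_period_multi[OF \<gamma>(1)] by (simp add: numeral_2_eq_2)
    show ?thesis unfolding \<phi>
    proof (rule zigzag_coboundary_criterion[OF z])
      show "\<gamma> \<in> Multi (Suc (Suc n))" using \<gamma>(1) True by (simp add: numeral_2_eq_2)
      show "hochschild_coboundary (Suc n) \<gamma> = 0" using \<gamma>(2) True by simp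
      show "cyclic_shift (bar_coboundary \<alpha>) = cyclic_shift \<gamma> - \<gamma>"
        unfolding \<gamma>(3)[symmetric] cyclic_shift_diff r ..
    qed
  next
    case False
    with less.prems(1) obtain m where n: "n = Suc (Suc m)" "even m"
      by (cases n; cases "n - 1") auto
    have "cyclic_norm (Suc n) \<alpha> \<in> B n"
      using less.IH[of m "cyclic_norm (Suc n) \<alpha>"] \<omega> 0 n by simp
    then show ?thesis unfolding \<phi> by (rule zigzag_coboundary[OF z])
  qed
qed

lemma even_cyclic_cocycles_pairing:
  assumes idem: "\<And>i. i \<in> I \<Longrightarrow> p i * p i = p i"
    and base: "\<And>v. \<exists>\<omega>\<in>Z 0. \<forall>i\<in>I. \<omega> [p i] = v i"
  shows "even n \<Longrightarrow> \<exists>\<phi>\<in>Z n. \<forall>i\<in>I. \<phi> (replicate (Suc n) (p i)) = v i"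
proof (induction n arbitrary: v rule: less_induct)
  case (less n)
  show ?case
  proof (cases "n = 0")
    case False
    with less.prems obtain m where n: "n = Suc (Suc m)" "even m"
      by (cases n; cases "n - 1") auto
    obtain \<omega> where \<omega>: "\<omega> \<in> Z m" "\<forall>i\<in>I. \<omega> (replicate (Suc m) (p i)) = 2 * of_nat (Suc m) * v i"
      using less.IH[of m "\<lambda>i. 2 * of_nat (Suc m) * v i"] n by auto
    obtain \<alpha> \<beta> where z: "zigzag m \<alpha> \<beta>" "cyclic_norm (Suc m) \<alpha> = \<omega>"
      using zigzag_exists[OF \<omega>(1)] by blast
    have "2 * complex_of_nat (Suc m) \<noteq> 0" by (simp del: of_nat_Suc)
    then have "hochschild_coboundary (Suc m) (cyclic_shift \<beta>) (replicate (Suc n) (p i)) = v i" if "i \<in> I" for i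
      using zigzag_pairing[OF z(1) idem[OF that] n(2)] \<omega>(2) that z(2) n
      by (metis mult_cancel_left)
    then show ?thesis using zigzag_cocycle[OF z(1)] n by blast
  qed (use base in simp)
qed

end

section \<open>Multilinear functionals on a group ring\<close>

abbreviation basis :: "'g \<Rightarrow> 'g \<Rightarrow>\<^sub>0 complex"
  where "basis g \<equiv> Poly_Mapping.single g 1"

lemma basis_mult: "basis g * basis h = basis (g + h)"
  by (simp add: Poly_Mapping.mult_single)

interpretation group_ring: complex_algebra "group_ring_scale :: complex \<Rightarrow> ('g::group_add \<Rightarrow>\<^sub>0 complex) \<Rightarrow> _"
  by (intro complex_algebra.intro complex_algebra_axioms.intro vector_space_group_ring group_ring_scale_mult)

fun extend :: "('g list \<Rightarrow> complex) \<Rightarrow> ('g \<Rightarrow>\<^sub>0 complex) list \<Rightarrow> complex"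
  where
    "extend f [] = f []"
  | "extend f (x # xs) = (\<Sum>g\<in>Poly_Mapping.keys x. Poly_Mapping.lookup x g * extend (\<lambda>gs. f (g # gs)) xs)"

definition multilinear_extension :: "nat \<Rightarrow> ('g list \<Rightarrow> complex) \<Rightarrow> ('g \<Rightarrow>\<^sub>0 complex) list \<Rightarrow> complex"
  where "multilinear_extension k f xs = (if length xs = k then extend f xs else 0)"

lemma sum_keys_superset:
  "finite S \<Longrightarrow> Poly_Mapping.keys x \<subseteq> S \<Longrightarrow>
    (\<Sum>g\<in>Poly_Mapping.keys x. Poly_Mapping.lookup x g * F g) = (\<Sum>g\<in>S. Poly_Mapping.lookup x g * (F g :: complex))"
  by (rule sum.mono_neutral_left) (auto simp: in_keys_iff)

lemma extend_slot_add: "extend f (us @ (a + b) # vs) = extend f (us @ a # vs) + extend f (us @ b # vs)"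
proof (induction us arbitrary: f)
  case Nil
  let ?S = "Poly_Mapping.keys a \<union> Poly_Mapping.keys b"
  let ?F = "\<lambda>g. extend (\<lambda>gs. f (g # gs)) vs"
  have "Poly_Mapping.keys (a + b) \<subseteq> ?S" by (rule Poly_Mapping.keys_add)
  then show ?case
    using sum_keys_superset[of ?S "a + b" ?F] sum_keys_superset[of ?S a ?F] sum_keys_superset[of ?S b ?F]
    by (simp add: Poly_Mapping.lookup_add sum.distrib algebra_simps)
qed (simp add: sum.distrib algebra_simps)

lemma extend_slot_scale: "extend f (us @ group_ring_scale c a # vs) = c * extend f (us @ a # vs)"
proof (induction us arbitrary: f)
  case Nil
  let ?F = "\<lambda>g. extend (\<lambda>gs. f (g # gs)) vs"
  have "Poly_Mapping.keys (group_ring_scale c a) \<subseteq> Poly_Mapping.keys a" by (auto simp: in_keys_iff lookup_group_ring_scale)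
  then show ?case
    using sum_keys_superset[of "Poly_Mapping.keys a" "group_ring_scale c a" ?F]
    by (simp add: lookup_group_ring_scale sum_distrib_left algebra_simps)
qed (simp add: sum_distrib_left algebra_simps)

lemma extend_basis: "extend f (map basis gs) = f gs"
  by (induction gs arbitrary: f) simp_all

lemma multilinear_extension_multi:
  "multilinear_extension k f \<in> multilinear_functionals (group_ring_scale :: _ \<Rightarrow> ('g::group_add \<Rightarrow>\<^sub>0 complex) \<Rightarrow> _) k"
  by (simp add: group_ring.multilinear_iff multilinear_extension_def extend_slot_add extend_slot_scale)

lemma multilinear_extension_basis:
  "length gs = k \<Longrightarrow> multilinear_extension k f (map basis gs) = f gs"
  by (simp add: multilinear_extension_def extend_basis)

lemma update_eq_add_scaled_basis:
  assumes "k \<notin> Poly_Mapping.keys f"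
  shows "Poly_Mapping.update k v f = f + group_ring_scale v (basis k)"
  using assms
  by (auto intro!: poly_mapping_eqI
      simp: Poly_Mapping.lookup_update Poly_Mapping.lookup_add Poly_Mapping.lookup_single
        lookup_group_ring_scale Poly_Mapping.in_keys_iff when_def)

text \<open>
  The entries are turned from basis vectors into arbitrary elements one after the other, from left
  to right in the induction hypothesis.
\<close>

lemma multilinear_zero_on_basis:
  fixes \<phi> :: "('g::group_add \<Rightarrow>\<^sub>0 complex) list \<Rightarrow> complex"
  assumes "\<phi> \<in> multilinear_functionals group_ring_scale k"
    and "\<And>gs. length gs = k \<Longrightarrow> \<phi> (map basis gs) = 0"
  shows "\<phi> = 0"
proof -
  have "length gs + length xs = k \<Longrightarrow> \<phi> (map basis gs @ xs) = 0" for gs xs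
  proof (induction xs arbitrary: gs)
    case (Cons x xs)
    then have k: "Suc (length (map basis gs) + length xs) = k" by simp
    note add = group_ring.multi_slot_add[OF assms(1) k] and scale = group_ring.multi_slot_scale[OF assms(1) k]
    have b: "\<phi> (map basis gs @ basis g # xs) = 0" for g
      using Cons.IH[of "gs @ [g]"] Cons.prems by simp
    show ?case
    proof (induction x rule: Poly_Mapping.update_induct)
      case const
      show ?case using scale[of 0 0] by (simp add: group_ring.scale_zero_left)
    next
      case (update f k v)
      then show ?case by (simp add: update_eq_add_scaled_basis add scale b)
    qed
  qed (simp add: assms(2))
  from this[of "[]"] have "\<phi> xs = 0" for xs
    using group_ring.multi_support[OF assms(1)] by (cases "length xs = k") auto
  then show ?thesis by (simp add: fun_eq_iff)
qed

lemma multilinear_eq_on_basis: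
  fixes \<phi> \<psi> :: "('g::group_add \<Rightarrow>\<^sub>0 complex) list \<Rightarrow> complex"
  assumes "\<phi> \<in> multilinear_functionals group_ring_scale k" "\<psi> \<in> multilinear_functionals group_ring_scale k"
    and "\<And>gs. length gs = k \<Longrightarrow> \<phi> (map basis gs) = \<psi> (map basis gs)"
  shows "\<phi> = \<psi>"
  using multilinear_zero_on_basis[OF group_ring.multi_diff[OF assms(1,2)]] assms(3)
  by (simp add: fun_eq_iff)

lemma bar_coboundary_cong_basis:
  fixes xs :: "'g::monoid_add list"
  assumes "\<And>ys. Suc (length ys) = length xs \<Longrightarrow> \<phi> (map basis ys) = \<psi> (map basis ys)"
  shows "bar_coboundary \<phi> (map basis xs) = bar_coboundary \<psi> (map basis xs)"
  using assms
proof (induction xs arbitrary: \<phi> \<psi>)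
  case (Cons x xs)
  show ?case
  proof (cases xs)
    case xs: (Cons y ys)
    have "bar_coboundary (\<lambda>ws. \<phi> (basis x # ws)) (map basis xs) =
        bar_coboundary (\<lambda>ws. \<psi> (basis x # ws)) (map basis xs)"
    proof (rule Cons.IH)
      fix zs :: "'g list" assume "Suc (length zs) = length xs"
      then show "\<phi> (basis x # map basis zs) = \<psi> (basis x # map basis zs)"
        using Cons.prems[of "x # zs"] by simp
    qed
    moreover have "\<phi> (basis (x + y) # map basis ys) = \<psi> (basis (x + y) # map basis ys)"
      using Cons.prems[of "(x + y) # ys"] xs by simp
    ultimately show ?thesis by (simp add: xs basis_mult)
  qed simp
qed simp

section \<open>Hochschild cohomology of groups with path integration\<close>

text \<open>
  The cocycle condition at a list that ends in \<open>y, a, b\<close>, solved for the faces that do not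
  involve \<open>a\<close> and \<open>b\<close>.
\<close>

lemma hochschild_cocycle_bar:
  fixes \<phi> :: "'a::ring_1 list \<Rightarrow> complex"
  assumes "hochschild_coboundary (m + 2) \<phi> = 0" "length ys = m"
  shows "bar_coboundary (\<lambda>us. \<phi> (c * hd us # tl us @ [a, b])) (x # ys @ [y]) =
    (- 1) ^ m * (\<phi> (c * x # ys @ [y * a, b]) - \<phi> (c * x # ys @ [y, a * b]) + \<phi> (b * c * x # ys @ [y, a]))"
proof -
  have "bar_coboundary (\<lambda>us. \<phi> (c * hd us # tl us @ [a, b])) (x # ys @ [y]) =
      bar_coboundary (\<lambda>us. \<phi> (us @ [a, b])) (c * x # ys @ [y])"
    using bar_coboundary_left_mult[of "\<lambda>us. \<phi> (us @ [a, b])" c x "ys @ [y]"] by simp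
  moreover have C: "bar_coboundary \<phi> ((c * x # ys @ [y]) @ [a, b]) =
      bar_coboundary (\<lambda>us. \<phi> (us @ [a, b])) (c * x # ys @ [y]) + (- 1) ^ (m + 1) * \<phi> (c * x # ys @ [y * a, b])
      + (- 1) ^ m * \<phi> (c * x # ys @ [y, a * b])"
    using bar_coboundary_snoc[of \<phi> "c * x # ys @ [y]" a b] assms(2)
      bar_coboundary_snoc[of "\<lambda>ws. \<phi> (ws @ [b])" "c * x # ys" y a]
    by simp
  moreover have "bar_coboundary \<phi> ((c * x # ys @ [y]) @ [a, b]) - (- 1) ^ m * \<phi> (b * c * x # ys @ [y, a]) = 0"
    using hochschild_coboundary_conv_bar[of "ys @ [y, a]" "m + 2" \<phi> "c * x" b] assms
    by (simp add: mult.assoc)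
  moreover have "b = s * (p - q + r)" if "b + - s * p + s * q - s * r = 0" for b p q r s :: complex
    using that by (simp add: algebra_simps)
  ultimately show ?thesis unfolding C by simp
qed

text \<open>
  A way of integrating functions of edges \<open>(u, v)\<close> along paths between group elements. Such an
  integral exists when the group has a Cayley graph that is a tree: integrate along the geodesic
  from \<open>x\<close> to \<open>y\<close>, antisymmetrised over the orientation of the edges so that elements which
  reverse an edge do no harm. The second rule says that the integral is invariant under the group, the third is the
  fundamental theorem of calculus.
\<close>

locale path_integration =
  fixes integral :: "'g::group_add \<Rightarrow> 'g \<Rightarrow> ('g \<Rightarrow> 'g \<Rightarrow> complex) \<Rightarrow> complex"
  assumes integral_concat: "integral x z e = integral x y e + integral y z e"
    and integral_translate: "integral (g + x) (g + y) e = integral x y (\<lambda>u v. e (g + u) (g + v))"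
    and integral_exact: "integral x y (\<lambda>u v. f v - f u) = f y - f x"
    and integral_diff: "integral x y (\<lambda>u v. e u v - e' u v) = integral x y e - integral x y e'"
    and integral_scale: "integral x y (\<lambda>u v. c * e u v) = c * integral x y e"
begin

lemma bar_coboundary_integral:
  "bar_coboundary (\<lambda>ws. integral x y (\<lambda>u v. F u v ws)) xs = integral x y (\<lambda>u v. bar_coboundary (F u v) xs)"
proof -
  have z: "integral x y (\<lambda>u v. 0) = 0" using integral_exact[of x y "\<lambda>_. 0"] by simp
  have "bar_coboundary G xs = integral x y (\<lambda>u v. bar_coboundary (F u v) xs)"
    if "\<And>ws. G ws = integral x y (\<lambda>u v. F u v ws)" for G
    using that
    by (induction G xs arbitrary: F rule: bar_coboundary.induct) (simp_all add: z integral_diff)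
  then show ?thesis by simp
qed

text \<open>
  In homogeneous coordinates \<open>x\<^sub>0, \<dots>, x\<^sub>n\<close> a chain is contracted by replacing its last
  entry by the edges \<open>(u, v)\<close> of the path from \<open>x\<^sub>n\<^sub>-\<^sub>1\<close> to
  \<open>x\<^sub>n\<close>. The boundary of the result consists of the original chain, of terms that cancel because
  path integrals add up, and of the degenerate chain in which \<open>x\<^sub>n\<^sub>-\<^sub>1\<close> is repeated; the
  last one is cancelled by subtracting the chain with \<open>x\<^sub>n\<^sub>-\<^sub>1\<close> repeated three times.
  Degree at least two is needed for \<open>x\<^sub>n\<^sub>-\<^sub>2\<close> to exist. The functional
  \<open>K\<close> in the proof is this homotopy in the coordinates \<open>g\<^sub>i = - x\<^sub>i\<^sub>-\<^sub>1 + x\<^sub>i\<close>, with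
  \<open>x\<^sub>n\<^sub>-\<^sub>1\<close> moved to 0.
\<close>

theorem hochschild_cocycle_exact:
  fixes \<phi> :: "('g \<Rightarrow>\<^sub>0 complex) list \<Rightarrow> complex"
  assumes "\<phi> \<in> multilinear_functionals group_ring_scale (m + 3)" "hochschild_coboundary (m + 2) \<phi> = 0"
  shows "\<exists>\<psi>\<in>multilinear_functionals group_ring_scale (m + 2). \<phi> = hochschild_coboundary (m + 1) \<psi>"
proof -
  \<comment> \<open>The sign that makes the homotopy formula read \<open>\<phi> = b \<psi>\<close>.\<close>
  define s :: complex where "s = - ((- 1) ^ m)"
  define K where "K ws g = integral 0 g (\<lambda>u v. \<phi> (basis (- v + g) * hd ws # tl ws @ [basis u, basis (- u + v)]))
    - \<phi> (basis g * hd ws # tl ws @ [basis 0, basis 0])" for ws g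
  define \<psi> where "\<psi> = multilinear_extension (m + 2) (\<lambda>ws. s * K (map basis (butlast ws)) (last ws))"
  have M: "\<psi> \<in> multilinear_functionals group_ring_scale (m + 2)"
    unfolding \<psi>_def by (rule multilinear_extension_multi)
  have \<psi>: "\<psi> (map basis ws @ [basis z]) = s * K (map basis ws) z" if "length ws = m + 1" for ws z
    using multilinear_extension_basis[of "ws @ [z]" "m + 2"] that by (simp add: \<psi>_def)
  have main: "hochschild_coboundary (m + 1) \<psi> (map basis (x # ys @ [y, z])) = \<phi> (map basis (x # ys @ [y, z]))"
    if ys: "length ys = m" for x ys y z
  proof -
    let ?ys = "map basis ys"
    define J where "J u v = \<phi> (basis (- v + (y + z) + x) # ?ys @ [basis u, basis (- u + v)])" for u v
    let ?D = "\<phi> (basis (y + z + x) # ?ys @ [basis 0, basis 0])"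
    have K1: "K (map basis (x # ys)) (y + z) = integral 0 (y + z) J - ?D"
      by (simp add: K_def J_def[abs_def] basis_mult add.assoc)
    have K2: "K (map basis ((z + x) # ys)) y = integral 0 y J - ?D"
      by (simp add: K_def J_def[abs_def] basis_mult add.assoc)
    \<comment> \<open>The cocycle condition turns an edge of the path from 0 to \<open>z\<close> into an edge of the translated path from \<open>y\<close> to \<open>y + z\<close> and a difference, which integrates to boundary values.\<close>
    have inner: "bar_coboundary (\<lambda>ws. \<phi> (basis (- v + z) * hd ws # tl ws @ [basis u, basis (- u + v)]))
          (map basis (x # ys @ [y])) =
        (- 1) ^ m * (J (y + u) (y + v)
          - (\<phi> (basis (- v + z + x) # ?ys @ [basis y, basis v]) - \<phi> (basis (- u + z + x) # ?ys @ [basis y, basis u])))"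
      for u v
    proof -
      have "- (y + v) + (y + z) + x = - v + z + x" "- (y + u) + (y + v) = - u + v"
          "(- u + v) + (- v + z) + x = - u + z + x"
        by (simp_all only: minus_add add.assoc minus_add_cancel add_minus_cancel)
      then show ?thesis
        using hochschild_cocycle_bar[OF assms(2), of ?ys "basis (- v + z)" "basis u" "basis (- u + v)" "basis x" "basis y"] ys
        by (simp add: basis_mult J_def)
    qed
    have degenerate: "bar_coboundary (\<lambda>ws. \<phi> (basis z * hd ws # tl ws @ [basis 0, basis 0])) (map basis (x # ys @ [y])) =
        (- 1) ^ m * \<phi> (basis (z + x) # ?ys @ [basis y, basis 0])"
      using hochschild_cocycle_bar[OF assms(2), of ?ys "basis z" "basis 0" "basis 0" "basis x" "basis y"] ys
      by (simp add: basis_mult)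
    have "bar_coboundary (\<lambda>ws. \<psi> (ws @ [basis z])) (map basis (x # ys @ [y])) =
        bar_coboundary (\<lambda>ws. s * K ws z) (map basis (x # ys @ [y]))"
      by (rule bar_coboundary_cong_basis) (simp add: \<psi> ys)
    also have "\<dots> = s * bar_coboundary (\<lambda>ws. K ws z) (map basis (x # ys @ [y]))"
      by (rule bar_coboundary_scale)
    also have "bar_coboundary (\<lambda>ws. K ws z) (map basis (x # ys @ [y])) =
        integral 0 z (\<lambda>u v. bar_coboundary (\<lambda>ws. \<phi> (basis (- v + z) * hd ws # tl ws @ [basis u, basis (- u + v)]))
          (map basis (x # ys @ [y])))
        - bar_coboundary (\<lambda>ws. \<phi> (basis z * hd ws # tl ws @ [basis 0, basis 0])) (map basis (x # ys @ [y]))"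
      unfolding K_def bar_coboundary_diff bar_coboundary_integral ..
    also have "\<dots> = integral 0 z (\<lambda>u v. (- 1) ^ m * (J (y + u) (y + v)
          - (\<phi> (basis (- v + z + x) # ?ys @ [basis y, basis v]) - \<phi> (basis (- u + z + x) # ?ys @ [basis y, basis u]))))
        - (- 1) ^ m * \<phi> (basis (z + x) # ?ys @ [basis y, basis 0])"
      using ys by (simp only: inner degenerate)
    also have "\<dots> = (- 1) ^ m * (integral 0 z (\<lambda>u v. J (y + u) (y + v))
        - (\<phi> (basis x # ?ys @ [basis y, basis z]) - \<phi> (basis (z + x) # ?ys @ [basis y, basis 0])))
        - (- 1) ^ m * \<phi> (basis (z + x) # ?ys @ [basis y, basis 0])"
      unfolding integral_scale integral_diff[of 0 z "\<lambda>u v. J (y + u) (y + v)"]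
      using integral_exact[of 0 z "\<lambda>v. \<phi> (basis (- v + z + x) # ?ys @ [basis y, basis v])"] by simp
    also have "integral 0 z (\<lambda>u v. J (y + u) (y + v)) = integral y (y + z) J"
      using integral_translate[of y 0 z J] by simp
    also have "\<dots> = integral 0 (y + z) J - integral 0 y J"
      using integral_concat[of 0 "y + z" J y] by simp
    finally have A: "bar_coboundary (\<lambda>ws. \<psi> (ws @ [basis z])) (map basis (x # ys @ [y])) =
        s * ((- 1) ^ m * (integral 0 (y + z) J - integral 0 y J - \<phi> (basis x # ?ys @ [basis y, basis z])))"
      by (simp add: algebra_simps)
    have "hochschild_coboundary (m + 1) \<psi> (map basis (x # ys @ [y, z])) =
        bar_coboundary \<psi> (map basis (x # ys) @ [basis y, basis z])
        + (- 1) ^ m * \<psi> (map basis ((z + x) # ys) @ [basis y])"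
      using hochschild_coboundary_conv_bar[of "?ys @ [basis y]" "m + 1" \<psi> "basis x" "basis z"] ys
      by (simp add: basis_mult)
    also have "bar_coboundary \<psi> (map basis (x # ys) @ [basis y, basis z]) =
        bar_coboundary (\<lambda>ws. \<psi> (ws @ [basis z])) (map basis (x # ys @ [y]))
        - (- 1) ^ m * \<psi> (map basis (x # ys) @ [basis (y + z)])"
      unfolding bar_coboundary_snoc using ys by (simp add: basis_mult)
    also note A
    also have "\<psi> (map basis (x # ys) @ [basis (y + z)]) = s * (integral 0 (y + z) J - ?D)"
      using \<psi>[of "x # ys" "y + z"] ys by (simp only: K1) simp
    also have "\<psi> (map basis ((z + x) # ys) @ [basis y]) = s * (integral 0 y J - ?D)"
      using \<psi>[of "(z + x) # ys" y] ys by (simp only: K2) simp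
    also have "s * ((- 1) ^ m * (integral 0 (y + z) J - integral 0 y J - \<phi> (basis x # ?ys @ [basis y, basis z])))
        - (- 1) ^ m * (s * (integral 0 (y + z) J - ?D)) + (- 1) ^ m * (s * (integral 0 y J - ?D)) =
        - (s * (- 1) ^ m) * \<phi> (basis x # ?ys @ [basis y, basis z])"
      by (simp add: algebra_simps)
    finally have "hochschild_coboundary (m + 1) \<psi> (map basis (x # ys @ [y, z])) =
        - (s * (- 1) ^ m) * \<phi> (basis x # ?ys @ [basis y, basis z])" .
    moreover have "- (s * (- 1) ^ m) = 1" by (simp add: s_def flip: power_add)
    ultimately show ?thesis by simp
  qed
  have "\<phi> = hochschild_coboundary (m + 1) \<psi>"
  proof (rule multilinear_eq_on_basis[OF assms(1)])
    show "hochschild_coboundary (m + 1) \<psi> \<in> multilinear_functionals group_ring_scale (m + 3)"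
      using group_ring.multi_hochschild_coboundary[of \<psi> "m + 1"] M by (simp add: numeral_3_eq_3)
  next
    fix gs :: "'g list" assume l: "length gs = m + 3"
    then obtain x us z where gs: "gs = x # us @ [z]" "length us = m + 1"
      using list_end_cases[of gs "m + 1"] by auto
    then obtain ys y where "us = ys @ [y]" "length ys = m"
      by (cases us rule: rev_cases) auto
    then show "\<phi> (map basis gs) = hochschild_coboundary (m + 1) \<psi> (map basis gs)"
      using main[of ys x y z] gs by simp
  qed
  with M show ?thesis by blast
qed

end

section \<open>Quotients of spaces of functionals\<close>

text \<open>
  First isomorphism theorem in the form used below: \<open>L\<close> maps the cocycles onto the target, and two
  cocycles have the same image exactly when they differ by a coboundary.
\<close>

lemma module_isomorphic_quotient:
  fixes V B :: "('x \<Rightarrow> complex) set" and N :: "(complex, 'b) module"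
  assumes V_add: "\<And>f g. f \<in> V \<Longrightarrow> g \<in> V \<Longrightarrow> f + g \<in> V"
    and V_scale: "\<And>c f. f \<in> V \<Longrightarrow> (\<lambda>x. c * f x) \<in> V"
    and B_V: "B \<subseteq> V" and B_zero: "0 \<in> B"
    and B_add: "\<And>f g. f \<in> B \<Longrightarrow> g \<in> B \<Longrightarrow> f + g \<in> B"
    and B_scale: "\<And>c f. f \<in> B \<Longrightarrow> (\<lambda>x. c * f x) \<in> B"
    and L_add: "\<And>f g. f \<in> V \<Longrightarrow> g \<in> V \<Longrightarrow> L (f + g) = L f \<oplus>\<^bsub>N\<^esub> L g"
    and L_scale: "\<And>c f. f \<in> V \<Longrightarrow> L (\<lambda>x. c * f x) = c \<odot>\<^bsub>N\<^esub> L f"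
    and L_image: "L ` V = carrier N"
    and L_eq: "\<And>f g. f \<in> V \<Longrightarrow> g \<in> V \<Longrightarrow> L f = L g \<longleftrightarrow> f - g \<in> B"
  shows "module_isomorphic complex_ring (quotient_module (functional_module V) B) N"
proof -
  let ?M = "functional_module V"
  define coset where "coset f = (\<lambda>b. b + f) ` B" for f :: "'x \<Rightarrow> complex"
  have coset: "B +>\<^bsub>?M\<^esub> f = coset f" for f
    by (auto simp: coset_def a_r_coset_def r_coset_def functional_module_def plus_fun_def)
  have carrier: "carrier (quotient_module ?M B) = coset ` V"
    by (auto simp: quotient_module_def A_RCOSETS_def RCOSETS_def coset[unfolded a_r_coset_def])
      (auto simp: functional_module_def)
  have B_uminus: "- f \<in> B" if "f \<in> B" for f
    using B_scale[OF that, of "- 1"] by (simp add: fun_Compl_def)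
  have mem: "g \<in> coset f \<longleftrightarrow> g - f \<in> B" for f g
  proof
    assume "g - f \<in> B"
    then have "g - f + f \<in> coset f" unfolding coset_def by blast
    then show "g \<in> coset f" by (simp del: plus_fun_apply minus_apply)
  qed (auto simp: coset_def simp del: plus_fun_apply minus_apply)
  have sub: "coset f \<subseteq> V" if "f \<in> V" for f
    using that B_V V_add by (auto simp: coset_def simp del: plus_fun_apply)
  define F where "F X = L (SOME f. f \<in> X)" for X
  have F: "F (coset f) = L f" if "f \<in> V" for f
  proof -
    have "f \<in> coset f" using B_zero by (simp add: mem)
    then have "(SOME g. g \<in> coset f) \<in> coset f" by (rule someI[of "\<lambda>g. g \<in> coset f"])
    then show ?thesis unfolding F_def using L_eq that sub mem by blast
  qed
  have coset_eq: "coset f = coset g" if "f - g \<in> B" for f g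
  proof -
    have "h - f \<in> B \<longleftrightarrow> h - g \<in> B" for h
    proof
      assume "h - f \<in> B"
      from B_add[OF this that] show "h - g \<in> B" by (simp del: plus_fun_apply minus_apply)
    next
      assume "h - g \<in> B"
      from B_add[OF this B_uminus[OF that]] show "h - f \<in> B" by (simp del: plus_fun_apply minus_apply)
    qed
    then show ?thesis by (auto simp: mem)
  qed
  have "bij_betw F (carrier (quotient_module ?M B)) (carrier N)"
    unfolding bij_betw_def carrier
  proof
    show "inj_on F (coset ` V)"
      by (auto intro!: inj_onI coset_eq simp: F L_eq)
    show "F ` coset ` V = carrier N"
      using F by (simp add: L_image[symmetric] image_image)
  qed
  moreover have "F (X \<oplus>\<^bsub>quotient_module ?M B\<^esub> Y) = F X \<oplus>\<^bsub>N\<^esub> F Y"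
    if XY: "X \<in> carrier (quotient_module ?M B)" "Y \<in> carrier (quotient_module ?M B)" for X Y
  proof -
    from XY obtain f g where f: "f \<in> V" "X = coset f" and g: "g \<in> V" "Y = coset g"
      unfolding carrier by blast
    have "X \<oplus>\<^bsub>quotient_module ?M B\<^esub> Y = (\<Union>h\<in>X. \<Union>k\<in>Y. {h + k})"
      by (simp add: quotient_module_def set_add_def set_mult_def functional_module_def plus_fun_def)
    also have "\<dots> = coset (f + g)"
    proof (intro equalityI subsetI)
      fix h assume "h \<in> (\<Union>h\<in>X. \<Union>k\<in>Y. {h + k})"
      then obtain b c where "b \<in> B" "c \<in> B" "h = (b + f) + (c + g)"
        by (auto simp: f g coset_def simp del: plus_fun_apply)
      then have "h = (b + c) + (f + g)" "b + c \<in> B"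
        using B_add by (simp_all add: algebra_simps del: plus_fun_apply)
      then show "h \<in> coset (f + g)" unfolding coset_def by blast
    next
      fix h assume "h \<in> coset (f + g)"
      then obtain b where "b \<in> B" "h = b + (f + g)" by (auto simp: coset_def simp del: plus_fun_apply)
      then have "h = (b + f) + (0 + g)" "b + f \<in> X" "0 + g \<in> Y"
        using B_zero by (auto simp: f g coset_def add.assoc simp del: plus_fun_apply)
      then show "h \<in> (\<Union>h\<in>X. \<Union>k\<in>Y. {h + k})" by blast
    qed
    finally show ?thesis using f g F V_add L_add by (simp del: plus_fun_apply)
  qed
  moreover have "F (c \<odot>\<^bsub>quotient_module ?M B\<^esub> X) = c \<odot>\<^bsub>N\<^esub> F X"
    if X: "X \<in> carrier (quotient_module ?M B)" for c X
  proof -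
    from X obtain f where f: "f \<in> V" "X = coset f" unfolding carrier by blast
    have "c \<odot>\<^bsub>quotient_module ?M B\<^esub> X = (\<Union>g\<in>X. coset (\<lambda>x. c * g x))"
      by (simp add: quotient_module_def coset) (simp add: functional_module_def)
    also have "\<dots> = coset (\<lambda>x. c * f x)"
    proof -
      have "coset (\<lambda>x. c * g x) = coset (\<lambda>x. c * f x)" if "g \<in> X" for g
      proof (rule coset_eq)
        have "g - f \<in> B" using that f mem by simp
        from B_scale[OF this, of c] show "(\<lambda>x. c * g x) - (\<lambda>x. c * f x) \<in> B"
          by (simp add: fun_diff_def algebra_simps)
      qed
      moreover have "f \<in> X" using B_zero f by (simp add: mem)
      ultimately show ?thesis by blast
    qed
    finally show ?thesis using f F V_scale L_scale by simp
  qed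
  ultimately show ?thesis unfolding module_isomorphic_def by auto
qed

section \<open>Degrees zero and one for group rings\<close>

text \<open>
  For fixed \<open>h\<close> the function \<open>F h x y\<close> of pairs is additive, like a difference of
  potentials at \<open>y\<close> and \<open>x\<close>, and it depends only on the orbit of
  \<open>(h, x, y)\<close> under the group. A potential with the same invariance is obtained by
  integrating from the point \<open>con h\<close> that conjugates \<open>h\<close> to the chosen
  representative of its class. This point is unique up to the centraliser of
  \<open>h\<close>, and along the centraliser \<open>F\<close> vanishes because the cocycle vanishes on
  commuting pairs.
\<close>

theorem cyclic_cocycle_1_exact:
  fixes \<phi> :: "('g::group_add \<Rightarrow>\<^sub>0 complex) list \<Rightarrow> complex"
  assumes \<phi>: "\<phi> \<in> cyclic_cocycles group_ring_scale 1"
    and comm: "\<And>g h. g + h = h + g \<Longrightarrow> \<phi> [basis g, basis h] = 0"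
  shows "\<phi> \<in> cyclic_coboundaries group_ring_scale 1"
proof -
  define F where "F h x y = \<phi> [basis (- y + h + x), basis (- x + y)]" for h x y
  have cocycle: "\<phi> [basis (a + b), basis c] - \<phi> [basis a, basis (b + c)] + \<phi> [basis (c + a), basis b] = 0" for a b c
  proof -
    have "hochschild_coboundary 1 \<phi> [basis a, basis b, basis c] = 0"
      using \<phi> by (simp add: group_ring.cyclic_cocycles_iff)
    then show ?thesis by (simp add: hochschild_coboundary_def basis_mult)
  qed
  have F_add: "F h x z = F h x y + F h y z" for h x y z
  proof -
    have e: "- z + h + x + (- x + y) = - z + h + y" "- x + y + (- y + z) = - x + z"
        "- y + z + (- z + h + x) = - y + h + x"
      by (simp_all only: add.assoc minus_add_cancel add_minus_cancel)
    show ?thesis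
      using cocycle[of "- z + h + x" "- x + y" "- y + z"]
      unfolding e F_def by (simp add: algebra_simps)
  qed
  \<comment> \<open>A conjugator to the representative of the class of \<open>h\<close>; conjugate elements get the same representative.\<close>
  define rel where "rel h r \<longleftrightarrow> (\<exists>c. c + r - c = h)" for h r :: 'g
  define rep where "rep h = (SOME r. rel h r)" for h
  define con where "con h = (SOME c. c + rep h - c = h)" for h
  have rel: "rel h h" for h unfolding rel_def by (rule exI[of _ 0]) simp
  have con: "con h + rep h - con h = h" for h
    using someI[of "rel h", OF rel] unfolding con_def rep_def rel_def by (rule someI_ex)
  have rep: "rep (- x + h + x) = rep h" for h x
  proof -
    have "rel (- x + h + x) r = rel h r" for r
    proof
      assume "rel (- x + h + x) r"
      then obtain c where "c + r - c = - x + h + x" unfolding rel_def by blast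
      then have "(x + c) + r - (x + c) = x + (- x + h + x) - x"
        by (metis diff_conv_add_uminus minus_add add.assoc)
      also have "\<dots> = h" by (simp add: add.assoc)
      finally show "rel h r" unfolding rel_def by blast
    next
      assume "rel h r"
      then obtain c where "c + r - c = h" unfolding rel_def by blast
      then have "(- x + c) + r - (- x + c) = - x + h + x"
        by (metis diff_conv_add_uminus minus_add add.assoc minus_minus)
      then show "rel (- x + h + x) r" unfolding rel_def by blast
    qed
    then show ?thesis unfolding rep_def by presburger
  qed
  define D where "D h = F h (con h) 0" for h
  have key: "\<phi> [basis a, basis x] = D (a + x) - D (x + a)" for a x
  proof -
    define h where "h = x + a"
    have h': "a + x = - x + h + x" by (simp add: h_def add.assoc)
    define c c' r where "c = con h" and "c' = con (a + x)" and "r = rep h"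
    have c: "c + r - c = h" unfolding c_def r_def by (rule con)
    have c': "c' + r - c' = a + x"
      using con[of "a + x"] rep[of x h] unfolding c'_def r_def h' by simp
    \<comment> \<open>Both \<open>c\<close> and \<open>x + c\'\<close> conjugate the representative to \<open>h\<close>, so they differ by an element of its centraliser.\<close>
    define w where "w = - c + (x + c')"
    have "(x + c') + r - (x + c') = x + (a + x) - x"
      unfolding c'[symmetric] by (simp only: diff_conv_add_uminus minus_add add.assoc)
    also have "\<dots> = h" by (simp add: h_def add.assoc diff_conv_add_uminus del: add_uminus_conv_diff)
    finally have xc: "(x + c') + r - (x + c') = h" .
    have hw: "h + (x + c') = (x + c') + r" using xc by (simp add: diff_eq_eq)
    have hc: "- c + h = r - c"
      using c by (metis add.assoc diff_conv_add_uminus minus_add_cancel)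
    have "w + r = - c + (h + (x + c'))" by (simp only: w_def hw add.assoc)
    also have "\<dots> = (- c + h) + (x + c')" by (simp only: add.assoc)
    also have "\<dots> = r + w" by (simp only: hc w_def diff_conv_add_uminus add.assoc)
    finally have wr: "w + r = r + w" .
    have "F h (x + c') c = \<phi> [basis (r + w), basis (- w)]"
      unfolding F_def hc by (simp add: w_def minus_add diff_conv_add_uminus add.assoc del: add_uminus_conv_diff)
    also have "\<dots> = 0"
      by (rule comm) (simp add: wr[symmetric] add.assoc, simp add: wr flip: add.assoc)
    finally have 1: "F h (x + c') c = 0" .
    have "D (a + x) = F h (x + c') x"
      unfolding D_def F_def c'_def[symmetric] h_def
      by (simp add: add.assoc minus_add diff_conv_add_uminus del: add_uminus_conv_diff)
    also have "\<dots> = F h c 0 + F h 0 x"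
      using F_add[of h "x + c'" x c] F_add[of h c x 0] 1 by simp
    also have "F h 0 x = \<phi> [basis a, basis x]" by (simp add: F_def h_def add.assoc)
    also have "F h c 0 = D (x + a)" by (simp add: D_def c_def h_def)
    finally show ?thesis by simp
  qed
  define \<delta> where "\<delta> = multilinear_extension 1 (\<lambda>ws. D (hd ws))"
  have \<delta>: "\<delta> \<in> multilinear_functionals group_ring_scale 1"
    unfolding \<delta>_def by (rule multilinear_extension_multi)
  have \<delta>_basis: "\<delta> [basis g] = D g" for g
    using multilinear_extension_basis[of "[g]" 1 "\<lambda>ws. D (hd ws)"] by (simp add: \<delta>_def)
  have "cyclic_shift \<delta> = \<delta>"
    using group_ring.rotation_period_multi[OF \<delta>] by simp
  then have "\<delta> \<in> cyclic_cochains group_ring_scale 0"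
    using \<delta> by (simp add: group_ring.cyclic_cochains_iff)
  moreover have "\<phi> = hochschild_coboundary 0 \<delta>"
  proof (rule multilinear_eq_on_basis)
    show "\<phi> \<in> multilinear_functionals group_ring_scale 2"
      using \<phi> by (simp add: group_ring.cyclic_cocycles_iff group_ring.cyclic_cochains_iff numeral_2_eq_2)
    show "hochschild_coboundary 0 \<delta> \<in> multilinear_functionals group_ring_scale 2"
      using group_ring.multi_hochschild_coboundary[of \<delta> 0] \<delta> by (simp add: numeral_2_eq_2)
    fix gs :: "'g list" assume "length gs = 2"
    then obtain a x where "gs = [a, x]" by (auto simp: numeral_2_eq_2 length_Suc_conv)
    then show "\<phi> (map basis gs) = hochschild_coboundary 0 \<delta> (map basis gs)"
      by (simp add: hochschild_coboundary_def basis_mult \<delta>_basis key)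
  qed
  ultimately show ?thesis
    using group_ring.cyclic_coboundaries_Suc[of 0] by auto
qed

lemma trace_cocycle:
  fixes f :: "'g::group_add \<Rightarrow> complex"
  assumes "\<And>g h. f (g + h) = f (h + g)"
  shows "\<exists>\<omega>\<in>cyclic_cocycles group_ring_scale 0. \<forall>g. \<omega> [basis g] = f g"
proof
  define \<omega> where "\<omega> = multilinear_extension 1 (\<lambda>ws. f (hd ws))"
  have M: "\<omega> \<in> multilinear_functionals group_ring_scale 1"
    unfolding \<omega>_def by (rule multilinear_extension_multi)
  have b: "\<omega> [basis g] = f g" for g
    using multilinear_extension_basis[of "[g]" 1 "\<lambda>ws. f (hd ws)"] by (simp add: \<omega>_def)
  then show "\<forall>g. \<omega> [basis g] = f g" ..
  have "cyclic_shift \<omega> = \<omega>"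
    using group_ring.rotation_period_multi[OF M] by simp
  moreover have "hochschild_coboundary 0 \<omega> = 0"
  proof (rule multilinear_zero_on_basis)
    show "hochschild_coboundary 0 \<omega> \<in> multilinear_functionals group_ring_scale 2"
      using group_ring.multi_hochschild_coboundary[of \<omega> 0] M by (simp add: numeral_2_eq_2)
    fix gs :: "'g list" assume "length gs = 2"
    then obtain a x where "gs = [a, x]" by (auto simp: numeral_2_eq_2 length_Suc_conv)
    then show "hochschild_coboundary 0 \<omega> (map basis gs) = 0"
      using assms by (simp add: hochschild_coboundary_def basis_mult b)
  qed
  ultimately show "\<omega> \<in> cyclic_cocycles group_ring_scale 0"
    using M by (simp add: group_ring.cyclic_cocycles_iff group_ring.cyclic_cochains_iff)
qed

lemma trace_property:
  fixes \<omega> :: "('g::group_add \<Rightarrow>\<^sub>0 complex) list \<Rightarrow> complex"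
  assumes "\<omega> \<in> cyclic_cocycles group_ring_scale 0"
  shows "\<omega> [basis (g + h)] = \<omega> [basis (h + g)]"
proof -
  have "hochschild_coboundary 0 \<omega> [basis g, basis h] = 0"
    using assms by (simp add: group_ring.cyclic_cocycles_iff)
  then show ?thesis by (simp add: hochschild_coboundary_def basis_mult)
qed

section \<open>The infinite dihedral group acting on a line\<close>

text \<open>
  The Cayley graph for the reflections \<open>e\<close> and \<open>S\<^sup>-\<^sup>1 e\<close> is a line: its vertices in order are
  \<open>\<dots>, S\<^sup>-\<^sup>1 e, 1, e, S, S e, S\<^sup>2, \<dots>\<close>. The position numbers them with \<open>1\<close> at 0.
\<close>

definition dihedral_position :: "dihedral \<Rightarrow> int"
  where "dihedral_position g = (case g of Dih k s \<Rightarrow> 2 * k + (if s = 0 then 0 else 1))"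

definition dihedral_at :: "int \<Rightarrow> dihedral"
  where "dihedral_at i = Dih (i div 2) (if even i then 0 else 1)"

text \<open>
  Reflections of the line reverse the edges, so only the antisymmetric part of an edge function has
  an invariant integral. Differences \<open>f v - f u\<close> are antisymmetric already.
\<close>

definition dihedral_edge :: "(dihedral \<Rightarrow> dihedral \<Rightarrow> complex) \<Rightarrow> int \<Rightarrow> complex"
  where "dihedral_edge e i =
    (e (dihedral_at i) (dihedral_at (i + 1)) - e (dihedral_at (i + 1)) (dihedral_at i)) / 2"

text \<open>
  The primitive of \<open>f\<close> that vanishes at 0; one of the two sums is always empty.
\<close>

definition int_primitive :: "(int \<Rightarrow> complex) \<Rightarrow> int \<Rightarrow> complex"
  where "int_primitive f j = (\<Sum>i\<in>{0..<j}. f i) - (\<Sum>i\<in>{j..<0}. f i)"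

definition dihedral_integral :: "dihedral \<Rightarrow> dihedral \<Rightarrow> (dihedral \<Rightarrow> dihedral \<Rightarrow> complex) \<Rightarrow> complex"
  where "dihedral_integral x y e =
    int_primitive (dihedral_edge e) (dihedral_position y) - int_primitive (dihedral_edge e) (dihedral_position x)"

lemma int_primitive_step: "int_primitive f (j + 1) - int_primitive f j = f j"
proof (cases "j \<ge> 0")
  case True
  then have "{0..<j + 1} = insert j {0..<j}" "{j..<0} = {}" "{j + 1..<0} = {}" by auto
  then show ?thesis by (simp add: int_primitive_def)
next
  case False
  then have "{j..<0} = insert j {j + 1..<0}" "{0..<j} = {}" "{0..<j + 1} = {}" by auto
  then show ?thesis by (simp add: int_primitive_def)
qed

lemma int_primitive_unique:
  assumes "\<And>j. F (j + 1) - F j = f j"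
  shows "int_primitive f j - int_primitive f i = F j - F i"
proof -
  have "int_primitive f j - F j = int_primitive f 0 - F 0" for j
  proof (induction j rule: int_induct[where k = 0])
    case (step1 i)
    then show ?case using int_primitive_step[of f i] assms[of i] by (simp add: algebra_simps)
  next
    case (step2 i)
    then show ?case using int_primitive_step[of f "i - 1"] assms[of "i - 1"] by (simp add: algebra_simps)
  qed simp
  then have e: "int_primitive f j = int_primitive f 0 - F 0 + F j" for j
    by (rule iffD1[OF diff_eq_eq])
  show ?thesis unfolding e[of j] e[of i] by simp
qed

lemma dihedral_at_position: "dihedral_at (dihedral_position g) = g"
  by (cases g) (auto simp: dihedral_at_def dihedral_position_def split: if_splits)

lemma dihedral_position_at: "dihedral_position (dihedral_at i) = i"
  by (simp add: dihedral_at_def dihedral_position_def)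

text \<open>
  Left multiplication acts on the line by even translations and by reflections in the midpoints of edges.
\<close>

lemma dihedral_translation:
  "Dih m 0 + dihedral_at i = dihedral_at (2 * m + i)"
  "Dih m 1 + dihedral_at i = dihedral_at (2 * m + 1 - i)"
  by (auto simp: dihedral_at_def elim!: oddE evenE)

text \<open>
  Each rule follows from the uniqueness of primitives on the integers: the two sides have the same
  increments.
\<close>

interpretation dihedral: path_integration dihedral_integral
proof
  fix x y z g :: dihedral and e e' :: "dihedral \<Rightarrow> dihedral \<Rightarrow> complex" and f :: "dihedral \<Rightarrow> complex"
    and c :: complex
  show "dihedral_integral x z e = dihedral_integral x y e + dihedral_integral y z e"
    by (simp add: dihedral_integral_def)
  show "dihedral_integral x y (\<lambda>u v. f v - f u) = f y - f x"
    using int_primitive_unique[of "\<lambda>i. f (dihedral_at i)" "dihedral_edge (\<lambda>u v. f v - f u)"]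
    by (simp add: dihedral_integral_def dihedral_at_position dihedral_edge_def)
  show "dihedral_integral x y (\<lambda>u v. e u v - e' u v) = dihedral_integral x y e - dihedral_integral x y e'"
  proof -
    let ?P = "\<lambda>i. int_primitive (dihedral_edge e) i - int_primitive (dihedral_edge e') i"
    have "?P (j + 1) - ?P j = dihedral_edge (\<lambda>u v. e u v - e' u v) j" for j
    proof -
      have "?P (j + 1) - ?P j = dihedral_edge e j - dihedral_edge e' j"
        unfolding int_primitive_step[of "dihedral_edge e" j, symmetric]
          int_primitive_step[of "dihedral_edge e'" j, symmetric] by simp
      also have "\<dots> = dihedral_edge (\<lambda>u v. e u v - e' u v) j"
        by (simp add: dihedral_edge_def diff_divide_distrib)
      finally show ?thesis .
    qed
    from int_primitive_unique[of ?P, OF this] show ?thesis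
      by (simp add: dihedral_integral_def)
  qed
  show "dihedral_integral x y (\<lambda>u v. c * e u v) = c * dihedral_integral x y e"
  proof -
    let ?P = "\<lambda>i. c * int_primitive (dihedral_edge e) i"
    have "?P (j + 1) - ?P j = dihedral_edge (\<lambda>u v. c * e u v) j" for j
    proof -
      have "?P (j + 1) - ?P j = c * dihedral_edge e j"
        unfolding int_primitive_step[of "dihedral_edge e" j, symmetric] by (rule right_diff_distrib[symmetric])
      also have "\<dots> = dihedral_edge (\<lambda>u v. c * e u v) j"
        by (simp add: dihedral_edge_def right_diff_distrib)
      finally show ?thesis .
    qed
    from int_primitive_unique[of ?P, OF this] show ?thesis
      by (simp only: dihedral_integral_def right_diff_distrib)
  qed
  show "dihedral_integral (g + x) (g + y) e = dihedral_integral x y (\<lambda>u v. e (g + u) (g + v))"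
  proof (cases g)
    case (Dih m s)
    let ?e = "\<lambda>u v. e (g + u) (g + v)" and ?P = "int_primitive (dihedral_edge e)"
    show ?thesis
    proof (cases "s = 0")
      case True
      have pos: "dihedral_position (g + x) = 2 * m + dihedral_position x" for x
        by (metis Dih True dihedral_translation(1) dihedral_at_position dihedral_position_at)
      have "?P (2 * m + (j + 1)) - ?P (2 * m + j) = dihedral_edge ?e j" for j
        using int_primitive_step[of "dihedral_edge e" "2 * m + j"]
        by (simp add: dihedral_edge_def Dih True dihedral_translation add.assoc)
      from int_primitive_unique[of "\<lambda>j. ?P (2 * m + j)", OF this]
      show ?thesis by (simp add: dihedral_integral_def pos)
    next
      case False
      then have s: "s = 1" by simp
      have pos: "dihedral_position (g + x) = 2 * m + 1 - dihedral_position x" for x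
        by (metis Dih s dihedral_translation(2) dihedral_at_position dihedral_position_at)
      have "?P (2 * m + 1 - (j + 1)) - ?P (2 * m + 1 - j) = dihedral_edge ?e j" for j
        using int_primitive_step[of "dihedral_edge e" "2 * m - j"]
        by (simp add: dihedral_edge_def Dih s dihedral_translation algebra_simps)
      from int_primitive_unique[of "\<lambda>j. ?P (2 * m + 1 - j)", OF this]
      show ?thesis by (simp add: dihedral_integral_def pos)
    qed
  qed
qed

section \<open>Cyclic 1-cocycles of the infinite dihedral group\<close>

abbreviation dih_Z where "dih_Z \<equiv> cyclic_cocycles (group_ring_scale :: _ \<Rightarrow> dihedral_group_ring \<Rightarrow> _)"
abbreviation dih_B where "dih_B \<equiv> cyclic_coboundaries (group_ring_scale :: _ \<Rightarrow> dihedral_group_ring \<Rightarrow> _)"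

lemma dihedral_zero: "0 = Dih 0 0" by (rule zero_dihedral_def)

text \<open>
  Commuting pairs are two translations, or contain the neutral element, or are two equal reflections.
  The last two kinds are settled by antisymmetry. On translations with product \<open>S\<^sup>m\<close> the
  cocycle is a multiple \<open>k t\<close> of a constant \<open>t\<close> in the exponent
  \<open>k\<close> of the second entry. If \<open>m \<noteq> 0\<close>, the value at
  \<open>k = m\<close> is zero, as the first entry is then neutral. If \<open>m = 0\<close>, the value is
  a homomorphism to the complex numbers, which vanishes on \<open>S\<close> because
  \<open>e S e = S\<^sup>-\<^sup>1\<close>.
\<close>

lemma dihedral_cyclic_1_cocycle_commuting:
  assumes \<phi>: "\<phi> \<in> dih_Z 1" and gh: "g + h = h + g"
  shows "\<phi> [basis g, basis h] = 0"
proof -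
  define f where "f a b = \<phi> [basis a, basis b]" for a b :: dihedral
  have cocycle: "f (a + b) c - f a (b + c) + f (c + a) b = 0" for a b c
  proof -
    have "hochschild_coboundary 1 \<phi> [basis a, basis b, basis c] = 0"
      using \<phi> by (simp add: group_ring.cyclic_cocycles_iff)
    then show ?thesis by (simp add: hochschild_coboundary_def basis_mult f_def)
  qed
  have "cyclic_shift \<phi> = \<phi>"
    using \<phi> by (simp add: group_ring.cyclic_cocycles_iff group_ring.cyclic_cochains_iff)
  from fun_cong[OF this] have "cyclic_shift \<phi> [basis a, basis b] = \<phi> [basis a, basis b]" for a b .
  then have antisym: "f b a = - f a b" for a b by (simp add: cyclic_shift_def f_def)
  have diag: "f a a = 0" for a using antisym[of a a] by simp
  have right0: "f a 0 = 0" for a using cocycle[of a 0 0] by simp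
  have left0: "f 0 a = 0" for a using antisym[of 0 a] right0 by simp
  have trans: "f (Dih (m - z) 0) (Dih z 0) = 0" for m z
  proof -
    define t where "t k = f (Dih (m - k) 0) (Dih k 0)" for k
    have t_add: "t (k + l) = t k + t l" for k l
      using cocycle[of "Dih (m - k - l) 0" "Dih k 0" "Dih l 0"] by (simp add: t_def algebra_simps)
    have t_int: "t k = of_int k * t 1" for k
    proof (induction k rule: int_induct[where k = 0])
      case base then show ?case using t_add[of 0 0] by simp
    next
      case (step1 i) then show ?case using t_add[of i 1] by (simp add: algebra_simps)
    next
      case (step2 i) then show ?case using t_add[of "i - 1" 1] by (simp add: algebra_simps)
    qed
    have "t 1 = 0"
    proof (cases "m = 0")
      case False
      have "t m = 0" using left0[of "Dih m 0"] by (simp add: t_def dihedral_zero)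
      with False t_int[of m] show ?thesis by simp
    next
      case True
      \<comment> \<open>On pairs of inverse elements a 1-cocycle is a homomorphism on the whole group.\<close>
      define \<chi> where "\<chi> a = f (- a) a" for a
      have \<chi>: "\<chi> (a + b) = \<chi> a + \<chi> b" for a b
      proof -
        have e: "- (a + b) + a = - b" "b + - (a + b) = - a"
          by (simp_all only: minus_add add.assoc minus_add_cancel add_minus_cancel) simp
        show ?thesis using cocycle[of "- (a + b)" a b] unfolding e \<chi>_def by (simp add: algebra_simps)
      qed
      have "\<chi> (Dih 0 1) + \<chi> (Dih 0 1) = \<chi> 0" by (simp flip: \<chi> add: dihedral_zero)
      then have "\<chi> (Dih 0 1) = 0" using \<chi>[of 0 0] by simp
      moreover have "\<chi> (Dih 0 1 + Dih 1 0 + Dih 0 1) = \<chi> (Dih 0 1) + \<chi> (Dih 1 0) + \<chi> (Dih 0 1)"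
        by (simp only: \<chi>)
      moreover have "\<chi> (Dih 1 0) + \<chi> (Dih (- 1) 0) = \<chi> 0" by (simp flip: \<chi> add: dihedral_zero)
      ultimately have "\<chi> (Dih 1 0) = 0" using \<chi>[of 0 0] by simp
      then show ?thesis by (simp add: t_def \<chi>_def True)
    qed
    then show ?thesis using t_int[of z] by (simp add: t_def)
  qed
  obtain k s l t where g: "g = Dih k s" and h: "h = Dih l t" by (cases g; cases h) auto
  have "f g h = 0"
  proof (cases s; cases t)
    assume "s = 0" "t = 0"
    then show ?thesis using trans[of "k + l" l] g h by simp
  next
    assume "s = 0" "t = 1"
    then show ?thesis using gh left0[of h] g h by (simp add: dihedral_zero)
  next
    assume "s = 1" "t = 0"
    then show ?thesis using gh right0[of g] g h by (simp add: dihedral_zero)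
  next
    assume "s = 1" "t = 1"
    then show ?thesis using gh diag[of g] g h by simp
  qed
  then show ?thesis by (simp add: f_def)
qed

section \<open>Traces of the infinite dihedral group\<close>

text \<open>
  The idempotents \<open>1\<close>, \<open>(1 + e) / 2\<close> and \<open>(1 + S e) / 2\<close> for
  \<open>i = 0, 1, 2\<close>: a trace is determined on the three conjugacy classes of elements of finite order
  by its values at them.
\<close>

definition dihedral_idempotent :: "nat \<Rightarrow> dihedral_group_ring"
  where "dihedral_idempotent i =
    (if i = 0 then 1 else group_ring_scale (1 / 2) (1 + basis (Dih (int i - 1) 1)))"

lemma dihedral_idempotent: "dihedral_idempotent i * dihedral_idempotent i = dihedral_idempotent i"
proof -
  let ?a = "basis (Dih (int i - 1) 1) :: dihedral_group_ring"
  have "?a * ?a = 1" by (simp add: basis_mult dihedral_zero[symmetric])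
  then have "(1 + ?a) * (1 + ?a) = group_ring_scale 2 (1 + ?a)"
    by (intro poly_mapping_eqI) (simp add: algebra_simps lookup_group_ring_scale lookup_add)
  then have "group_ring_scale (1 / 2) (1 + ?a) * group_ring_scale (1 / 2) (1 + ?a) = group_ring_scale (1 / 2) (1 + ?a)"
    by (simp add: group_ring.scale_scale flip: group_ring_scale_mult)
  then show ?thesis by (simp add: dihedral_idempotent_def)
qed

lemma trace_dihedral_idempotent:
  assumes "\<omega> \<in> dih_Z 0"
  shows "\<omega> [dihedral_idempotent i] =
    (if i = 0 then \<omega> [basis 0] else (\<omega> [basis 0] + \<omega> [basis (Dih (int i - 1) 1)]) / 2)"
proof -
  have M: "\<omega> \<in> multilinear_functionals group_ring_scale 1"
    using assms by (simp add: group_ring.cyclic_cocycles_iff group_ring.cyclic_cochains_iff)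
  show ?thesis
    using group_ring.multi_slot_scale[OF M, of "[]" "[]"] group_ring.multi_slot_add[OF M, of "[]" "[]"]
    by (simp add: dihedral_idempotent_def)
qed

text \<open>
  Conjugation by \<open>S\<^sup>k\<close> changes the exponent in \<open>S\<^sup>m e\<close> by \<open>2 k\<close>, and
  conjugation by a reflection inverts \<open>S\<^sup>m\<close>.
\<close>

lemma dihedral_trace_reps:
  assumes "\<omega> \<in> dih_Z 0"
  shows "\<omega> [basis (Dih m 1)] = \<omega> [basis (Dih (m mod 2) 1)]" and "\<omega> [basis (Dih (- m) 0)] = \<omega> [basis (Dih m 0)]"
proof -
  define k where "k = m div 2"
  have "Dih k 0 + Dih (m - k) 1 = Dih m 1" "Dih (m - k) 1 + Dih k 0 = Dih (m - 2 * k) 1" by simp_all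
  moreover have "m - 2 * k = m mod 2" unfolding k_def by (simp add: minus_mult_div_eq_mod)
  ultimately show "\<omega> [basis (Dih m 1)] = \<omega> [basis (Dih (m mod 2) 1)]"
    using trace_property[OF assms] by metis
  have "Dih 0 1 + Dih m 1 = Dih (- m) 0" "Dih m 1 + Dih 0 1 = Dih m 0" by simp_all
  then show "\<omega> [basis (Dih (- m) 0)] = \<omega> [basis (Dih m 0)]"
    using trace_property[OF assms] by metis
qed

lemma dihedral_trace_eqI:
  assumes \<omega>: "\<omega> \<in> dih_Z 0" "\<omega>' \<in> dih_Z 0"
    and "\<omega> [basis 0] = \<omega>' [basis 0]"
    and "\<omega> [basis (Dih 0 1)] = \<omega>' [basis (Dih 0 1)]"
    and "\<omega> [basis (Dih 1 1)] = \<omega>' [basis (Dih 1 1)]"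
    and p: "\<And>p. p \<ge> 1 \<Longrightarrow> \<omega> [basis (Dih (int p) 0)] = \<omega>' [basis (Dih (int p) 0)]"
  shows "\<omega> = \<omega>'"
proof (rule multilinear_eq_on_basis)
  show "\<omega> \<in> multilinear_functionals group_ring_scale 1" "\<omega>' \<in> multilinear_functionals group_ring_scale 1"
    using \<omega> by (simp_all add: group_ring.cyclic_cocycles_iff group_ring.cyclic_cochains_iff)
  fix gs :: "dihedral list" assume "length gs = 1"
  then obtain m s where gs: "gs = [Dih m s]" by (auto simp: length_Suc_conv) (metis dihedral.exhaust)
  have "\<omega> [basis (Dih m s)] = \<omega>' [basis (Dih m s)]"
  proof (cases "s = 0")
    case True
    show ?thesis
    proof (cases m)
      case (nonneg n)
      then show ?thesis using p[of n] assms(3) True by (cases "n = 0") (simp_all add: dihedral_zero)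
    next
      case (neg n)
      then show ?thesis
        using p[of "Suc n"] True dihedral_trace_reps(2)[OF \<omega>(1), of "int (Suc n)"]
          dihedral_trace_reps(2)[OF \<omega>(2), of "int (Suc n)"] by simp
    qed
  next
    case False
    have "m mod 2 = 0 \<or> m mod 2 = 1" by presburger
    with False show ?thesis
      using dihedral_trace_reps(1)[OF \<omega>(1), of m] dihedral_trace_reps(1)[OF \<omega>(2), of m] assms(4,5)
      by auto
  qed
  then show "\<omega> (map basis gs) = \<omega>' (map basis gs)" by (simp add: gs)
qed

lemma dihedral_trace_exists:
  "\<exists>\<omega>\<in>dih_Z 0. \<omega> [basis 0] = a (0::nat) \<and> \<omega> [basis (Dih 0 1)] = a 1 \<and> \<omega> [basis (Dih 1 1)] = a 2 \<and>
    (\<forall>p\<ge>1. \<omega> [basis (Dih (int p) 0)] = b p)"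
proof -
  define f where "f g = (case g of Dih m s \<Rightarrow>
    if s = 0 then if m = 0 then a 0 else b (nat \<bar>m\<bar>) else if even m then a 1 else a 2)" for g
  have "f (g + h) = f (h + g)" for g h
    by (cases g; cases h) (auto simp: f_def abs_minus_commute add.commute split: if_splits)
  then obtain \<omega> where "\<omega> \<in> dih_Z 0" "\<forall>g. \<omega> [basis g] = f g"
    using trace_cocycle by blast
  then show ?thesis by (intro bexI[of _ \<omega>]) (simp_all add: f_def dihedral_zero)
qed

text \<open>
  The exponent of \<open>S\<close>: a crossed homomorphism to the integers, on which reflections act by
  the sign.
\<close>

definition dihedral_shift :: "dihedral \<Rightarrow> int" where "dihedral_shift g = (case g of Dih m s \<Rightarrow> m)"

text \<open>
  For \<open>h = S\<^sup>m\<close> with \<open>m \<noteq> 0\<close> the Hochschild classes supported on the conjugates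
  of \<open>h\<close> come from the cohomology of the centraliser, which is infinite cyclic. Its
  generator in degree 1 is the crossed homomorphism \<open>t = dihedral_shift\<close>, normalised to take the
  value 1 at \<open>h\<close>; this gives the cocycle \<open>\<gamma> (a, b) = \<omega> (b a) t(b) / t(b a)\<close>.
  The normalisation makes \<open>\<gamma> (a, b) + \<gamma> (b, a) = \<omega> (a b)\<close>. Where
  \<open>t(b a) = 0\<close> or \<open>b a\<close> is a reflection, the trace vanishes and so does \<open>\<gamma>\<close>.
\<close>

lemma dihedral_trace_killed:
  assumes \<omega>: "\<omega> \<in> dih_Z 0"
    and "\<omega> [basis 0] = 0" "\<omega> [basis (Dih 0 1)] = 0" "\<omega> [basis (Dih 1 1)] = 0"
  shows "\<exists>\<gamma>\<in>multilinear_functionals group_ring_scale 2.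
    hochschild_coboundary 1 \<gamma> = 0 \<and> \<gamma> - cyclic_shift \<gamma> = bar_coboundary \<omega>"
proof -
  define w where "w g = \<omega> [basis g]" for g
  define G where "G a b = w (b + a) * of_int (dihedral_shift b) / of_int (dihedral_shift (b + a))" for a b
  define \<gamma> where "\<gamma> = multilinear_extension 2 (\<lambda>ws. G (hd ws) (last ws))"
  have \<gamma>: "\<gamma> \<in> multilinear_functionals group_ring_scale 2"
    unfolding \<gamma>_def by (rule multilinear_extension_multi)
  have \<gamma>_basis: "\<gamma> [basis a, basis b] = G a b" for a b
    using multilinear_extension_basis[of "[a, b]" 2 "\<lambda>ws. G (hd ws) (last ws)"] by (simp add: \<gamma>_def)
  have M: "\<omega> \<in> multilinear_functionals group_ring_scale 1"
    using \<omega> by (simp add: group_ring.cyclic_cocycles_iff group_ring.cyclic_cochains_iff)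
  have w_comm: "w (a + b) = w (b + a)" for a b
    unfolding w_def by (rule trace_property[OF \<omega>])
  have w_refl: "w (Dih m 1) = 0" for m
  proof -
    have "m mod 2 = 0 \<or> m mod 2 = 1" by presburger
    then show ?thesis using dihedral_trace_reps(1)[OF \<omega>, of m] assms by (auto simp: w_def)
  qed
  have w_one: "w (Dih 0 0) = 0" using assms by (simp add: w_def dihedral_zero)
  have w_neg: "w (Dih (- m) 0) = w (Dih m 0)" for m
    unfolding w_def by (rule dihedral_trace_reps(2)[OF \<omega>])
  have G_sum: "G a b + G b a = w (a + b)" for a b
  proof -
    obtain k s l t where ab: "a = Dih k s" "b = Dih l t" by (cases a; cases b) auto
    have lk: "w (Dih (l - k) 0) = w (Dih (k - l) 0)" using w_neg[of "k - l"] by simp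
    show ?thesis
    proof (cases s; cases t)
      assume st: "s = 0" "t = 0"
      show ?thesis
      proof (cases "k + l = 0")
        case True then show ?thesis using st ab w_one by (simp add: G_def add.commute)
      next
        case False
        then have "of_int k + of_int l \<noteq> (0 :: complex)" by (simp flip: of_int_add)
        then have "w (a + b) * of_int l / of_int (k + l) + w (a + b) * of_int k / of_int (k + l) = w (a + b)"
          by (simp add: add.commute flip: add_divide_distrib distrib_left)
        then show ?thesis using st ab by (simp add: G_def dihedral_shift_def add.commute)
      qed
    next
      assume st: "s = 1" "t = 1"
      show ?thesis
      proof (cases "k = l")
        case True then show ?thesis using st ab w_one by (simp add: G_def)
      next
        case False
        then have d: "of_int l - of_int k \<noteq> (0 :: complex)" by simp
        let ?W = "w (Dih (k - l) 0)"
        have "?W * of_int k / (of_int k - of_int l) = - (?W * of_int k / (of_int l - of_int k))"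
          by (metis minus_diff_eq divide_minus_right)
        moreover have "?W * of_int l / (of_int l - of_int k) - ?W * of_int k / (of_int l - of_int k) = ?W"
          using d by (simp flip: diff_divide_distrib right_diff_distrib)
        ultimately show ?thesis using st ab lk by (simp add: G_def dihedral_shift_def)
      qed
    qed (use ab w_refl in \<open>simp_all add: G_def\<close>)
  qed
  have G_cocycle: "G (a + b) c - G a (b + c) + G (c + a) b = 0" for a b c
  proof -
    have wc: "w (c + (a + b)) = w (b + c + a)" using w_comm[of "c + a" b] by (simp add: add.assoc)
    define h where "h = b + c + a"
    obtain k s where b: "b = Dih k s" by (cases b)
    obtain l t where c: "c = Dih l t" by (cases c)
    obtain m u where h: "h = Dih m u" by (cases h)
    have "c + (a + b) = - b + h + b" by (simp add: h_def add.assoc)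
    then have cab: "c + (a + b) = Dih (if s = 0 then m else - m) 0" if "u = 0"
      using that by (auto simp: b h)
    show ?thesis
    proof (cases "u = 0 \<and> m \<noteq> 0")
      case True
      then have u: "u = 0" by simp
      have "G (a + b) c = w h * of_int l / of_int (if s = 0 then m else - m)"
        unfolding G_def wc h_def[symmetric] unfolding cab[OF u] by (simp add: dihedral_shift_def c)
      moreover have "G a (b + c) = w h * of_int (k + (if s = 0 then l else - l)) / of_int m"
        unfolding G_def h_def[symmetric] by (simp add: dihedral_shift_def h b c)
      moreover have "G (c + a) b = w h * of_int k / of_int m"
        unfolding G_def add.assoc[symmetric] h_def[symmetric] by (simp add: dihedral_shift_def h b)
      moreover have "x * z / y - x * (v + z) / y + x * v / y = 0"
          "x * z / - y - x * (v - z) / y + x * v / y = 0" for x y z v :: complex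
        by (simp_all add: add_divide_distrib diff_divide_distrib distrib_left right_diff_distrib)
      ultimately show ?thesis by (cases "s = 0") simp_all
    next
      case False
      then have "w h = 0" using w_refl w_one by (cases "u = 0") (auto simp: h)
      then show ?thesis unfolding G_def wc using h_def by (simp add: add.assoc)
    qed
  qed
  have "hochschild_coboundary 1 \<gamma> = 0"
  proof (rule multilinear_zero_on_basis)
    show "hochschild_coboundary 1 \<gamma> \<in> multilinear_functionals group_ring_scale 3"
      using group_ring.multi_hochschild_coboundary[of \<gamma> 1] \<gamma> by (simp add: numeral_eq_Suc)
    fix gs :: "dihedral list" assume "length gs = 3"
    then obtain a b c where "gs = [a, b, c]" by (auto simp: numeral_3_eq_3 length_Suc_conv)
    then show "hochschild_coboundary 1 \<gamma> (map basis gs) = 0"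
      using G_cocycle[of a b c] by (simp add: hochschild_coboundary_def basis_mult \<gamma>_basis)
  qed
  moreover have "\<gamma> - cyclic_shift \<gamma> = bar_coboundary \<omega>"
  proof (rule multilinear_eq_on_basis)
    show "\<gamma> - cyclic_shift \<gamma> \<in> multilinear_functionals group_ring_scale 2"
      by (intro group_ring.multi_diff group_ring.multi_cyclic_shift \<gamma>)
    show "bar_coboundary \<omega> \<in> multilinear_functionals group_ring_scale 2"
      using group_ring.multi_bar_coboundary[OF M] by (simp add: numeral_2_eq_2)
    fix gs :: "dihedral list" assume "length gs = 2"
    then obtain a b where "gs = [a, b]" by (auto simp: numeral_2_eq_2 length_Suc_conv)
    then show "(\<gamma> - cyclic_shift \<gamma>) (map basis gs) = bar_coboundary \<omega> (map basis gs)"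
      using G_sum[of a b] by (simp add: cyclic_shift_def basis_mult \<gamma>_basis w_def)
  qed
  ultimately show ?thesis using \<gamma> by blast
qed

section \<open>The cohomology groups\<close>

lemma cyclic_cohomology_dihedral_isomorphic:
  fixes N :: "(complex, 'b) module"
  assumes "\<And>\<phi> \<psi>. \<phi> \<in> dih_Z n \<Longrightarrow> \<psi> \<in> dih_Z n \<Longrightarrow> L (\<phi> + \<psi>) = L \<phi> \<oplus>\<^bsub>N\<^esub> L \<psi>"
    and "\<And>c \<phi>. \<phi> \<in> dih_Z n \<Longrightarrow> L (\<lambda>xs. c * \<phi> xs) = c \<odot>\<^bsub>N\<^esub> L \<phi>"
    and "L ` dih_Z n = carrier N"
    and "\<And>\<phi> \<psi>. \<phi> \<in> dih_Z n \<Longrightarrow> \<psi> \<in> dih_Z n \<Longrightarrow> L \<phi> = L \<psi> \<longleftrightarrow> \<phi> - \<psi> \<in> dih_B n"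
  shows "module_isomorphic complex_ring (cyclic_cohomology_dihedral n) N"
  unfolding cyclic_cohomology_def
  by (rule module_isomorphic_quotient[of _ _ L])
    (use assms in \<open>simp_all add: group_ring.Z_add group_ring.Z_scale group_ring.B_subset_Z group_ring.B_zero
      group_ring.B_add group_ring.B_scale del: plus_fun_apply minus_apply zero_fun_apply\<close>)

lemma complex_power_simps:
  "carrier (complex_power I) = {f. \<forall>i. i \<notin> I \<longrightarrow> f i = 0}"
  "f \<oplus>\<^bsub>complex_power I\<^esub> g = (\<lambda>i. f i + g i)"
  "c \<odot>\<^bsub>complex_power I\<^esub> f = (\<lambda>i. c * f i)"
  by (simp_all add: complex_power_def functional_module_def)

lemma module_prod_simps:
  "carrier (module_prod M N) = carrier M \<times> carrier N"
  "(x, y) \<oplus>\<^bsub>module_prod M N\<^esub> (x', y') = (x \<oplus>\<^bsub>M\<^esub> x', y \<oplus>\<^bsub>N\<^esub> y')"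
  "c \<odot>\<^bsub>module_prod M N\<^esub> (x, y) = (c \<odot>\<^bsub>M\<^esub> x, c \<odot>\<^bsub>N\<^esub> y)"
  by (simp_all add: module_prod_def)

lemma less_3_iff: "i < (3::nat) \<longleftrightarrow> i = 0 \<or> i = 1 \<or> i = 2"
  by auto

text \<open>
  In degree 0 the cocycles are the class functions, and the conjugacy classes are those of
  \<open>1\<close>, \<open>e\<close>, \<open>S e\<close> and the pairs \<open>{S\<^sup>p, S\<^sup>-\<^sup>p}\<close> with
  \<open>p \<ge> 1\<close>.
\<close>

lemma dihedral_HC_0:
  "module_isomorphic complex_ring (cyclic_cohomology_dihedral 0)
    (module_prod (complex_power {..<3::nat}) (complex_power {1::nat..}))"
proof (rule cyclic_cohomology_dihedral_isomorphic)
  define g :: "nat \<Rightarrow> dihedral" where "g i = (if i = 0 then 0 else Dih (int i - 1) 1)" for i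
  define L where "L \<phi> = ((\<lambda>i::nat. if i < 3 then \<phi> [basis (g i)] else (0::complex)),
      (\<lambda>p::nat. if p \<ge> 1 then \<phi> [basis (Dih (int p) 0)] else (0::complex)))"
    for \<phi> :: "dihedral_group_ring list \<Rightarrow> complex"
  let ?N = "module_prod (complex_power {..<3::nat}) (complex_power {1::nat..})"
  show "L (\<phi> + \<psi>) = L \<phi> \<oplus>\<^bsub>?N\<^esub> L \<psi>" for \<phi> \<psi>
    by (auto simp: L_def module_prod_simps complex_power_simps)
  show "L (\<lambda>xs. c * \<phi> xs) = c \<odot>\<^bsub>?N\<^esub> L \<phi>" for c \<phi>
    by (auto simp: L_def module_prod_simps complex_power_simps)
  show "L \<phi> = L \<psi> \<longleftrightarrow> \<phi> - \<psi> \<in> dih_B 0" if "\<phi> \<in> dih_Z 0" "\<psi> \<in> dih_Z 0" for \<phi> \<psi>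
  proof
    assume eq: "L \<phi> = L \<psi>"
    have "\<phi> [basis (g i)] = \<psi> [basis (g i)]" if "i < 3" for i
      using fun_cong[of _ _ i, OF arg_cong[OF eq, of fst]] that by (simp add: L_def)
    from this[of 0] this[of 1] this[of 2]
    have "\<phi> [basis 0] = \<psi> [basis 0]" "\<phi> [basis (Dih 0 1)] = \<psi> [basis (Dih 0 1)]"
        "\<phi> [basis (Dih 1 1)] = \<psi> [basis (Dih 1 1)]"
      by (simp_all add: g_def)
    moreover have "\<phi> [basis (Dih (int p) 0)] = \<psi> [basis (Dih (int p) 0)]" if "p \<ge> 1" for p
      using fun_cong[of _ _ p, OF arg_cong[OF eq, of snd]] that by (simp add: L_def)
    ultimately have "\<phi> = \<psi>" using dihedral_trace_eqI that by blast
    then show "\<phi> - \<psi> \<in> dih_B 0" by (simp add: group_ring.cyclic_coboundaries_0 del: minus_apply)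
  next
    assume "\<phi> - \<psi> \<in> dih_B 0"
    then have "\<phi> - \<psi> = 0" by (simp add: group_ring.cyclic_coboundaries_0 del: minus_apply)
    then show "L \<phi> = L \<psi>" by (simp del: minus_apply)
  qed
  show "L ` dih_Z 0 = carrier ?N"
  proof
    show "L ` dih_Z 0 \<subseteq> carrier ?N"
      by (auto simp: L_def module_prod_simps complex_power_simps)
    show "carrier ?N \<subseteq> L ` dih_Z 0"
    proof
      fix ab assume ab: "ab \<in> carrier ?N"
      obtain a b where [simp]: "ab = (a, b)" by (cases ab)
      obtain \<omega> where \<omega>: "\<omega> \<in> dih_Z 0" "\<omega> [basis 0] = a 0" "\<omega> [basis (Dih 0 1)] = a 1"
          "\<omega> [basis (Dih 1 1)] = a 2" "\<forall>p\<ge>1. \<omega> [basis (Dih (int p) 0)] = b p"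
        using dihedral_trace_exists[of a b] by blast
      have "\<omega> [basis (g i)] = a i" if "i < 3" for i
        using that \<omega> by (auto simp: less_3_iff g_def)
      then have "L \<omega> = ab"
        using ab \<omega>(5) by (auto simp: L_def module_prod_simps complex_power_simps fun_eq_iff not_less_eq_eq)
      with \<omega>(1) show "ab \<in> L ` dih_Z 0" by blast
    qed
  qed
qed

lemma dihedral_HC_odd:
  assumes "odd n"
  shows "module_isomorphic complex_ring (cyclic_cohomology_dihedral n) (complex_power ({} :: nat set))"
proof (rule cyclic_cohomology_dihedral_isomorphic)
  have "dih_Z 1 \<subseteq> dih_B 1"
    using cyclic_cocycle_1_exact dihedral_cyclic_1_cocycle_commuting by blast
  then have ZB: "dih_Z n \<subseteq> dih_B n"
    using group_ring.odd_cyclic_cocycles_exact[OF dihedral.hochschild_cocycle_exact] assms by blast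
  let ?L = "\<lambda>\<phi> :: dihedral_group_ring list \<Rightarrow> complex. (\<lambda>i::nat. 0 :: complex)"
  show "?L (\<phi> + \<psi>) = ?L \<phi> \<oplus>\<^bsub>complex_power {}\<^esub> ?L \<psi>" for \<phi> \<psi> by (simp add: complex_power_simps)
  show "?L (\<lambda>xs. c * \<phi> xs) = c \<odot>\<^bsub>complex_power {}\<^esub> ?L \<phi>" for c \<phi> by (simp add: complex_power_simps)
  show "?L ` dih_Z n = carrier (complex_power {})"
    using group_ring.Z_zero[of n] by (auto simp: complex_power_simps)
  show "?L \<phi> = ?L \<psi> \<longleftrightarrow> \<phi> - \<psi> \<in> dih_B n" if "\<phi> \<in> dih_Z n" "\<psi> \<in> dih_Z n" for \<phi> \<psi>
    using group_ring.Z_diff[OF that] ZB by blast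
qed

lemma dihedral_HC_even:
  assumes "even n" "n \<ge> 2"
  shows "module_isomorphic complex_ring (cyclic_cohomology_dihedral n) (complex_power {..<3::nat})"
proof (rule cyclic_cohomology_dihedral_isomorphic)
  let ?p = dihedral_idempotent
  define L where "L \<phi> = (\<lambda>i. if i < 3 then \<phi> (replicate (Suc n) (?p i)) else (0::complex))"
    for \<phi> :: "dihedral_group_ring list \<Rightarrow> complex"
  obtain m where n: "n = Suc (Suc m)" "even m"
    using assms by (cases n; cases "n - 1") auto
  show "L (\<phi> + \<psi>) = L \<phi> \<oplus>\<^bsub>complex_power {..<3}\<^esub> L \<psi>" for \<phi> \<psi>
    by (auto simp: L_def complex_power_simps)
  show "L (\<lambda>xs. c * \<phi> xs) = c \<odot>\<^bsub>complex_power {..<3}\<^esub> L \<phi>" for c \<phi>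
    by (auto simp: L_def complex_power_simps)
  show "L \<phi> = L \<psi> \<longleftrightarrow> \<phi> - \<psi> \<in> dih_B n" if "\<phi> \<in> dih_Z n" "\<psi> \<in> dih_Z n" for \<phi> \<psi>
  proof
    assume eq: "L \<phi> = L \<psi>"
    have base: "\<exists>\<gamma>\<in>multilinear_functionals group_ring_scale 2. hochschild_coboundary 1 \<gamma> = 0 \<and>
        \<gamma> - cyclic_shift \<gamma> = bar_coboundary \<omega>"
      if \<omega>: "\<omega> \<in> dih_Z 0" and 0: "\<And>i. i \<in> {..<3} \<Longrightarrow> \<omega> [?p i] = 0" for \<omega>
      using 0[of 0] 0[of 1] 0[of 2]
      by (intro dihedral_trace_killed \<omega>) (simp_all add: trace_dihedral_idempotent[OF \<omega>])
    have "(\<phi> - \<psi>) (replicate (Suc (Suc (Suc m))) (?p i)) = 0" if "i \<in> {..<3}" for i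
      using fun_cong[OF eq, of i] that n by (simp add: L_def)
    moreover have "\<phi> - \<psi> \<in> dih_Z (Suc (Suc m))"
      using group_ring.Z_diff[OF that] n(1) by simp
    ultimately show "\<phi> - \<psi> \<in> dih_B n"
      unfolding n(1)
      by (intro group_ring.even_cyclic_cocycles_exact[where I = "{..<3}" and p = ?p]
          dihedral.hochschild_cocycle_exact dihedral_idempotent base n(2))
  next
    assume B: "\<phi> - \<psi> \<in> dih_B n"
    have "\<phi> (replicate (Suc n) (?p i)) = \<psi> (replicate (Suc n) (?p i))" for i
      using group_ring.coboundary_pairing[OF B dihedral_idempotent assms(1), of i] by simp
    then show "L \<phi> = L \<psi>" by (simp only: L_def)
  qed
  show "L ` dih_Z n = carrier (complex_power {..<3})"
  proof
    show "L ` dih_Z n \<subseteq> carrier (complex_power {..<3})"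
      by (auto simp: L_def complex_power_simps)
    show "carrier (complex_power {..<3}) \<subseteq> L ` dih_Z n"
    proof
      fix v :: "nat \<Rightarrow> complex" assume v: "v \<in> carrier (complex_power {..<3})"
      have base: "\<exists>\<omega>\<in>dih_Z 0. \<forall>i\<in>{..<3}. \<omega> [?p i] = v i" for v :: "nat \<Rightarrow> complex"
      proof -
        obtain \<omega> where \<omega>: "\<omega> \<in> dih_Z 0" "\<omega> [basis 0] = v 0" "\<omega> [basis (Dih 0 1)] = 2 * v 1 - v 0"
            "\<omega> [basis (Dih 1 1)] = 2 * v 2 - v 0"
          using dihedral_trace_exists[of "\<lambda>i. if i = 0 then v 0 else 2 * v i - v 0" undefined] by auto
        then have "\<omega> [?p i] = v i" if "i \<in> {..<3}" for i
          using that by (auto simp: less_3_iff trace_dihedral_idempotent[OF \<omega>(1)])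
        with \<omega>(1) show ?thesis by blast
      qed
      obtain \<phi> where \<phi>: "\<phi> \<in> dih_Z n" "\<forall>i\<in>{..<3}. \<phi> (replicate (Suc n) (?p i)) = v i"
        using group_ring.even_cyclic_cocycles_pairing[OF dihedral_idempotent base assms(1)] by blast
      then have "L \<phi> = v" using v by (auto simp: L_def complex_power_simps fun_eq_iff)
      with \<phi>(1) show "v \<in> L ` dih_Z n" by blast
    qed
  qed
qed

theorem proposition11:
  shows "module_isomorphic complex_ring (cyclic_cohomology_dihedral 0)
           (module_prod (complex_power {..<3::nat}) (complex_power {1::nat..})) \<and>
         (\<forall>n. odd n \<longrightarrow>
           module_isomorphic complex_ring (cyclic_cohomology_dihedral n)
             (complex_power ({} :: nat set))) \<and>
         (\<forall>n. even n \<and> n \<ge> 2 \<longrightarrow>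
           module_isomorphic complex_ring (cyclic_cohomology_dihedral n)
             (complex_power {..<3::nat}))"
  using dihedral_HC_0 dihedral_HC_odd dihedral_HC_even by blast

end
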